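(* (In NF.) For every set $A$ there exists a relative adjunction $(A\times-)\;{}_{T}\!\dashv(A\Rightarrow-)$ on $\mathbf{N}$; that is, there is a bijection $$\hom(A\times C,B)\cong\hom(TC,A\Rightarrow B)$$ natural in $C$ and $B$.
   Context: NF is the set theory axiomatised by extensionality and comprehension for stratifiable formulae. Ordered pairs are type-level Quine pairs. $\mathbf{N}$ is the category of all NF sets and all functions whose graphs are sets; $\hom$ refers to $\mathbf{N}$. $T:\mathbf{N}\to\mathbf{N}$ is the functor with $TX=\{\{x\}:x\in X\}$ and $Tf(\{a\})=\{f(a)\}$. $A\Rightarrow B$ denotes the set of all functions from $A$ to $B$, and $A\Rightarrow-$ acts on morphisms by postcomposition. For functors $J,F,G$, the relative adjunction $F\;{}_{J}\!\dashv G$ means a natural bijection between morphisms $FX\to Y$ and morphisms $JX\to GY$. *)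

theory Defs
  imports Main
begin

datatype fm =
    Mem nat nat
  | Eq nat nat
  | Neg fm
  | Conj fm fm
  | All nat fm

primrec sat :: "('a \<Rightarrow> 'a \<Rightarrow> bool) \<Rightarrow> (nat \<Rightarrow> 'a) \<Rightarrow> fm \<Rightarrow> bool" where
  "sat E e (Mem x y) \<longleftrightarrow> E (e x) (e y)"
| "sat E e (Eq x y) \<longleftrightarrow> e x = e y"
| "sat E e (Neg p) \<longleftrightarrow> \<not> sat E e p"
| "sat E e (Conj p q) \<longleftrightarrow> sat E e p \<and> sat E e q"
| "sat E e (All x p) \<longleftrightarrow> (\<forall>a. sat E (e(x := a)) p)"

text \<open>The argument \<open>s\<close> assigns types to the free variables.  Each quantifier chooses the type
  of the variable it binds, so that a bound name may be reused at several types; this is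
  stratifiability up to renaming of bound variables.\<close>

primrec strat :: "(nat \<Rightarrow> int) \<Rightarrow> fm \<Rightarrow> bool" where
  "strat s (Mem x y) \<longleftrightarrow> s y = s x + 1"
| "strat s (Eq x y) \<longleftrightarrow> s x = s y"
| "strat s (Neg p) \<longleftrightarrow> strat s p"
| "strat s (Conj p q) \<longleftrightarrow> strat s p \<and> strat s q"
| "strat s (All x p) \<longleftrightarrow> (\<exists>k. strat (s(x := k)) p)"

definition stratifiable :: "fm \<Rightarrow> bool" where
  "stratifiable p \<longleftrightarrow> (\<exists>s. strat s p)"

text \<open>The action of an endofunctor on a morphism also takes the domain and codomain of that
  morphism, because a graph does not determine its codomain.\<close>

record 'a endofunctor =
  obj :: "'a \<Rightarrow> 'a"
  mor :: "'a \<Rightarrow> 'a \<Rightarrow> 'a \<Rightarrow> 'a"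

locale nf_structure =
  fixes mem :: "'a \<Rightarrow> 'a \<Rightarrow> bool"  (infix "\<epsilon>" 50)
begin

text \<open>\<open>setof P\<close> is meaningful only if the extension of \<open>P\<close> is a set.  In NF this holds for
  every use below, since each of the predicates is given by a stratifiable formula.\<close>

definition setof :: "('a \<Rightarrow> bool) \<Rightarrow> 'a" where
  "setof P = (THE y. \<forall>x. x \<epsilon> y \<longleftrightarrow> P x)"

definition empty :: 'a where
  "empty = setof (\<lambda>z. False)"

definition sing :: "'a \<Rightarrow> 'a" where
  "sing x = setof (\<lambda>z. z = x)"

definition un :: "'a \<Rightarrow> 'a \<Rightarrow> 'a" where
  "un x y = setof (\<lambda>z. z \<epsilon> x \<or> z \<epsilon> y)"

text \<open>Frege natural numbers: \<open>n\<close> is the set of all sets with exactly \<open>n\<close> elements.\<close>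

definition zero :: 'a where
  "zero = sing empty"

definition succ :: "'a \<Rightarrow> 'a" where
  "succ n = setof (\<lambda>z. \<exists>x y. x \<epsilon> n \<and> \<not> y \<epsilon> x \<and> z = un x (sing y))"

definition Nn :: 'a where
  "Nn = setof (\<lambda>n. \<forall>I. zero \<epsilon> I \<and> (\<forall>m. m \<epsilon> I \<longrightarrow> succ m \<epsilon> I) \<longrightarrow> n \<epsilon> I)"

text \<open>Quine pairs: \<open>shift\<close> increments the natural numbers among the elements of a set, so that
  \<open>zero\<close> can be used as a marker for the elements of the second component.\<close>

definition shift :: "'a \<Rightarrow> 'a" where
  "shift x = setof (\<lambda>z. (z \<epsilon> x \<and> \<not> z \<epsilon> Nn) \<or> (\<exists>n. n \<epsilon> x \<and> n \<epsilon> Nn \<and> z = succ n))"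

definition pair :: "'a \<Rightarrow> 'a \<Rightarrow> 'a" where
  "pair a b = setof (\<lambda>z. (\<exists>x. x \<epsilon> a \<and> z = shift x) \<or>
                          (\<exists>x. x \<epsilon> b \<and> z = un (shift x) (sing zero)))"

definition prod :: "'a \<Rightarrow> 'a \<Rightarrow> 'a" where
  "prod A B = setof (\<lambda>p. \<exists>a b. a \<epsilon> A \<and> b \<epsilon> B \<and> p = pair a b)"

definition hom :: "'a \<Rightarrow> 'a \<Rightarrow> 'a set" where
  "hom A B = {f. (\<forall>p. p \<epsilon> f \<longrightarrow> p \<epsilon> prod A B) \<and> (\<forall>a. a \<epsilon> A \<longrightarrow> (\<exists>!b. pair a b \<epsilon> f))}"

definition app :: "'a \<Rightarrow> 'a \<Rightarrow> 'a" where
  "app f a = (THE b. pair a b \<epsilon> f)"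

definition ident :: "'a \<Rightarrow> 'a" where
  "ident X = setof (\<lambda>p. \<exists>x. x \<epsilon> X \<and> p = pair x x)"

definition comp :: "'a \<Rightarrow> 'a \<Rightarrow> 'a" where
  "comp g f = setof (\<lambda>p. \<exists>a b c. pair a b \<epsilon> f \<and> pair b c \<epsilon> g \<and> p = pair a c)"

definition is_endofunctor :: "'a endofunctor \<Rightarrow> bool" where
  "is_endofunctor F \<longleftrightarrow>
     (\<forall>X Y. \<forall>f \<in> hom X Y. mor F X Y f \<in> hom (obj F X) (obj F Y)) \<and>
     (\<forall>X. mor F X X (ident X) = ident (obj F X)) \<and>
     (\<forall>X Y Z. \<forall>f \<in> hom X Y. \<forall>g \<in> hom Y Z.
        mor F X Z (comp g f) = comp (mor F Y Z g) (mor F X Y f))"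

definition T_functor :: "'a endofunctor" where
  "T_functor =
     \<lparr>obj = (\<lambda>X. setof (\<lambda>z. \<exists>x. x \<epsilon> X \<and> z = sing x)),
      mor = (\<lambda>X Y f. setof (\<lambda>p. \<exists>x. x \<epsilon> X \<and> p = pair (sing x) (sing (app f x))))\<rparr>"

definition prod_functor :: "'a \<Rightarrow> 'a endofunctor" where
  "prod_functor A =
     \<lparr>obj = (\<lambda>X. prod A X),
      mor = (\<lambda>X Y f. setof (\<lambda>p. \<exists>a x. a \<epsilon> A \<and> x \<epsilon> X \<and>
                                p = pair (pair a x) (pair a (app f x))))\<rparr>"

definition exp_functor :: "'a \<Rightarrow> 'a endofunctor" where
  "exp_functor A =
     \<lparr>obj = (\<lambda>X. setof (\<lambda>f. f \<in> hom A X)),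
      mor = (\<lambda>X Y k. setof (\<lambda>p. \<exists>f. f \<in> hom A X \<and> p = pair f (comp k f)))\<rparr>"

text \<open>The components of \<open>\<Phi>\<close> are maps on the meta level and not elements of the structure: in
  the adjunction of interest they raise the type by one, so their graphs need not be sets.\<close>

definition relative_adjunction ::
    "'a endofunctor \<Rightarrow> 'a endofunctor \<Rightarrow> 'a endofunctor \<Rightarrow> ('a \<Rightarrow> 'a \<Rightarrow> 'a \<Rightarrow> 'a) \<Rightarrow> bool" where
  "relative_adjunction J F G \<Phi> \<longleftrightarrow>
     is_endofunctor J \<and> is_endofunctor F \<and> is_endofunctor G \<and>
     (\<forall>X Y. bij_betw (\<Phi> X Y) (hom (obj F X) Y) (hom (obj J X) (obj G Y))) \<and>
     (\<forall>X X' Y Y'. \<forall>h \<in> hom X' X. \<forall>k \<in> hom Y Y'. \<forall>f \<in> hom (obj F X) Y.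
        \<Phi> X' Y' (comp k (comp f (mor F X' X h))) =
        comp (mor G Y Y' k) (comp (\<Phi> X Y f) (mor J X' X h)))"

text \<open>The maps \<open>\<Phi> X Y\<close> on \<open>hom (obj F X) Y\<close> form a class of the theory: \<open>p\<close> defines them, with
  the set \<open>A\<close> as its only parameter (the value of \<open>p\<close> must not depend on \<open>e\<close>).  The variables
  0 to 4 stand for \<open>A\<close>, \<open>X\<close>, \<open>Y\<close>, the argument and the value.\<close>

definition defined_by ::
    "fm \<Rightarrow> 'a \<Rightarrow> 'a endofunctor \<Rightarrow> ('a \<Rightarrow> 'a \<Rightarrow> 'a \<Rightarrow> 'a) \<Rightarrow> bool" where
  "defined_by p A F \<Phi> \<longleftrightarrow>
     (\<forall>X Y f g e. f \<in> hom (obj F X) Y \<longrightarrow>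
        (sat mem (e(0 := A, 1 := X, 2 := Y, 3 := f, 4 := g)) p \<longleftrightarrow> g = \<Phi> X Y f))"

end

text \<open>Models of NF.  In the comprehension scheme \<open>e\<close> supplies the parameters and \<open>v\<close> is the
  variable abstracted over; the new set \<open>y\<close> is not the value of any variable of \<open>p\<close>.\<close>

locale NF = nf_structure +
  assumes extensionality: "(\<And>z. z \<epsilon> x \<longleftrightarrow> z \<epsilon> y) \<Longrightarrow> x = y"
    and comprehension: "stratifiable p \<Longrightarrow> \<exists>y. \<forall>x. x \<epsilon> y \<longleftrightarrow> sat mem (e(v := x)) p"

end

theory Submission
  imports Defs
begin

text \<open>The bijection is transposition: a function \<open>f\<close> from \<open>A \<times> C\<close> to \<open>B\<close> corresponds to
\<open>{c} \<mapsto> (a \<mapsto> f (a, c))\<close>.  The graph \<open>a \<mapsto> f (a, c)\<close> lies one type above \<open>c\<close>, so the definition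
of the class of pairs \<open>(c, a \<mapsto> f (a, c))\<close> is not stratified, whereas with \<open>{c}\<close> in place of \<open>c\<close>
both components have the same type.  This is the reason for the functor \<open>T\<close>.  Once
transposition and its inverse are known to exist as sets, bijectivity and naturality follow by
evaluating functions at points (\<open>transpose_adjunction\<close>).  The class of all transpositions is given
by one formula for all models, because its stratified definition never refers to a particular
model (\<open>transpose_definable\<close>).

Two ingredients carry the weight.  The first is a calculus of stratified predicates and terms, which
reduces the existence of each set to a type check of its defining predicate.

The second is the Axiom of Infinity.  Quine pairs are ordered pairs only if the successor is injective
on the Frege natural numbers, and this holds only if the universe is not finite, a theorem of NF due to
Specker.  It is proved here by a parity argument.  Suppose the universe \<open>V\<close> is finite and call \<open>u\<close> a
logarithm of \<open>v\<close> if, up to equinumerosity, \<open>u = {{y} : y \<in> x}\<close> and \<open>v\<close> is the power set \<open>P(x)\<close> of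
the same \<open>x\<close>.  Consider the game in which two players in turn replace the current set by one of its logarithms and
a player without a move loses.  It terminates, since logarithms are smaller, and the set \<open>W\<close> of
positions won by the player to move is definable without parameters.  Logarithms are unique
up to equinumerosity, so \<open>P(x) \<in> W\<close> holds iff \<open>{{y} : y \<in> x} \<notin> W\<close> (\<open>winning_pow\<close>).  On
the other hand the logarithms of \<open>{{y} : y \<in> x}\<close> are exactly the images under the same operation of
the logarithms of \<open>x\<close>, so \<open>{{y} : y \<in> x} \<in> W\<close> iff \<open>x \<in> W\<close> (\<open>winning_singletons\<close>).  With \<open>x = V = P(V)\<close>
the two equivalences contradict each other.\<close>

section \<open>Stratified predicates and terms\<close>

primrec rename :: "(nat \<Rightarrow> nat) \<Rightarrow> fm \<Rightarrow> fm" where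
  "rename r (Mem x y) = Mem (r x) (r y)"
| "rename r (Eq x y) = Eq (r x) (r y)"
| "rename r (Neg p) = Neg (rename r p)"
| "rename r (Conj p q) = Conj (rename r p) (rename r q)"
| "rename r (All x p) = All (r x) (rename r p)"

primrec var_bound :: "fm \<Rightarrow> nat" where
  "var_bound (Mem x y) = max (Suc x) (Suc y)"
| "var_bound (Eq x y) = max (Suc x) (Suc y)"
| "var_bound (Neg p) = var_bound p"
| "var_bound (Conj p q) = max (var_bound p) (var_bound q)"
| "var_bound (All x p) = max (Suc x) (var_bound p)"

text \<open>Renaming acts on bound variables as well, so it is the injectivity of the renaming that prevents
capture.\<close>

lemma update_comp_inj: "inj r \<Longrightarrow> (e(r x := a)) \<circ> r = (e \<circ> r)(x := a)"
  by (auto simp: fun_eq_iff inj_eq)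

lemma sat_rename: "inj r \<Longrightarrow> sat E e (rename r p) = sat E (e \<circ> r) p"
  by (induction p arbitrary: e) (auto simp: update_comp_inj simp del: comp_apply, auto)

lemma strat_rename: "inj r \<Longrightarrow> strat s (rename r p) = strat (s \<circ> r) p"
  by (induction p arbitrary: s) (auto simp: update_comp_inj simp del: comp_apply, auto)

lemma sat_cong:
  "(\<And>n. n < var_bound p \<Longrightarrow> e n = e' n) \<Longrightarrow> sat E e p = sat E e' p"
proof (induction p arbitrary: e e')
  case (All x p)
  have "sat E (e(x := a)) p = sat E (e'(x := a)) p" for a
    by (rule All.IH) (use All.prems in auto)
  then show ?case by simp
next
  case (Conj p q)
  have "sat E e p = sat E e' p" by (rule Conj.IH(1)) (use Conj.prems in auto)
  moreover have "sat E e q = sat E e' q" by (rule Conj.IH(2)) (use Conj.prems in auto)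
  ultimately show ?case by simp
next
  case (Neg p)
  have "sat E e p = sat E e' p" by (rule Neg.IH) (use Neg.prems in auto)
  then show ?case by simp
qed auto

definition has_level :: "nat list \<Rightarrow> nat \<Rightarrow> nat \<Rightarrow> bool" where
  "has_level s n k \<longleftrightarrow> n < length s \<and> s ! n = k"

text \<open>The type assignment \<open>l\<close> is left arbitrary outside the list \<open>s\<close>.  A formula that is stratified under
all such \<open>l\<close> can therefore be reused in a longer context.\<close>

definition levels :: "nat list \<Rightarrow> (nat \<Rightarrow> int) \<Rightarrow> bool" where
  "levels s l \<longleftrightarrow> (\<forall>n k. has_level s n k \<longrightarrow> l n = int k)"

text \<open>These rules follow the syntax of a predicate and leave the levels of bound variables to unification.
Levels are natural numbers built with \<open>Suc\<close>, so that solving the constraint ``one level higher'' is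
first-order unification.\<close>

named_theorems strat_intros

lemma has_level_0 [strat_intros]: "has_level (k # s) 0 k"
  by (simp add: has_level_def)

lemma has_level_Suc [strat_intros]: "has_level s n k \<Longrightarrow> has_level (k' # s) (Suc n) k"
  by (simp add: has_level_def)

lemma has_level_Cons_iff:
  "has_level (k' # s) n k \<longleftrightarrow> (case n of 0 \<Rightarrow> k' = k | Suc m \<Rightarrow> has_level s m k)"
  by (auto simp: has_level_def split: nat.split)

text \<open>Formulas are considered uniformly over a family of models.  The constant family gives instances of
comprehension in one model; the family of all models gives a single formula that defines
the same notion everywhere.\<close>

locale NF_family =
  fixes I :: "'i set" and M :: "'i \<Rightarrow> 'a \<Rightarrow> 'a \<Rightarrow> bool"
  assumes NF_M: "i \<in> I \<Longrightarrow> NF (M i)"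
begin

text \<open>A predicate reads the values of its variables from an environment, the variable bound last at
position 0; \<open>s\<close> lists their levels.  Quantifiers push a new value onto the environment, so no names
occur in predicates.\<close>

definition stratified :: "nat list \<Rightarrow> ('i \<Rightarrow> (nat \<Rightarrow> 'a) \<Rightarrow> bool) \<Rightarrow> bool" where
  "stratified s P \<longleftrightarrow>
     (\<exists>p. (\<forall>l. levels s l \<longrightarrow> strat l p) \<and> (\<forall>i\<in>I. \<forall>e. sat (M i) e p \<longleftrightarrow> P i e))"

definition stratified_term ::
    "nat list \<Rightarrow> nat \<Rightarrow> ('i \<Rightarrow> (nat \<Rightarrow> 'a) \<Rightarrow> 'a) \<Rightarrow> bool" where
  "stratified_term s k t \<longleftrightarrow> stratified (k # s) (\<lambda>i e. e 0 = t i (\<lambda>n. e (Suc n)))"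

lemma stratifiedI:
  "(\<And>l. levels s l \<Longrightarrow> strat l p) \<Longrightarrow> (\<And>i e. i \<in> I \<Longrightarrow> sat (M i) e p \<longleftrightarrow> P i e) \<Longrightarrow> stratified s P"
  unfolding stratified_def by blast

lemma stratified_uniform_formula:
  "stratified s P \<Longrightarrow> \<exists>p. \<forall>i. i \<in> I \<longrightarrow> (\<forall>e. sat (M i) e p \<longleftrightarrow> P i e)"
  unfolding stratified_def by metis

lemma stratified_cong:
  assumes "stratified s P" "\<And>i e. i \<in> I \<Longrightarrow> P i e = Q i e"
  shows "stratified s Q"
  using assms unfolding stratified_def by metis

lemma stratified_rename:
  assumes P: "stratified s P" and r: "inj r"
    and lev: "\<And>n k. has_level s n k \<Longrightarrow> has_level s' (r n) k"
  shows "stratified s' (\<lambda>i e. P i (\<lambda>n. e (r n)))"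
proof -
  obtain p where p: "\<And>l. levels s l \<Longrightarrow> strat l p"
      "\<And>i e. i \<in> I \<Longrightarrow> sat (M i) e p \<longleftrightarrow> P i e"
    using P unfolding stratified_def by blast
  show ?thesis
  proof (rule stratifiedI)
    fix l assume "levels s' l"
    then have "levels s (l \<circ> r)" using lev by (auto simp: levels_def)
    then show "strat l (rename r p)" using r p(1) by (simp add: strat_rename)
  next
    fix i e assume "i \<in> I"
    then show "sat (M i) e (rename r p) = P i (\<lambda>n. e (r n))"
      using r p(2) by (simp add: sat_rename comp_def)
  qed
qed

lemma stratified_not [strat_intros]: "stratified s P \<Longrightarrow> stratified s (\<lambda>i e. \<not> P i e)"
proof -
  assume "stratified s P"
  then obtain p where "\<And>l. levels s l \<Longrightarrow> strat l p"
      "\<And>i e. i \<in> I \<Longrightarrow> sat (M i) e p \<longleftrightarrow> P i e"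
    unfolding stratified_def by blast
  then show ?thesis by (intro stratifiedI[of _ "Neg p"]) auto
qed

lemma stratified_conj [strat_intros]:
  "stratified s P \<Longrightarrow> stratified s Q \<Longrightarrow> stratified s (\<lambda>i e. P i e \<and> Q i e)"
proof -
  assume "stratified s P" "stratified s Q"
  then obtain p q where "\<And>l. levels s l \<Longrightarrow> strat l p \<and> strat l q"
      "\<And>i e. i \<in> I \<Longrightarrow> sat (M i) e p \<longleftrightarrow> P i e" "\<And>i e. i \<in> I \<Longrightarrow> sat (M i) e q \<longleftrightarrow> Q i e"
    unfolding stratified_def by blast
  then show ?thesis by (intro stratifiedI[of _ "Conj p q"]) auto
qed

text \<open>Here positions have to be turned into named variables: the variable at position 0 becomes a
variable \<open>m\<close> that is fresh for the formula, and the other positions move down by one.\<close>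

lemma stratified_all [strat_intros]:
  assumes "stratified (k # s) (\<lambda>i e. R i (\<lambda>n. e (Suc n)) (e 0))"
  shows "stratified s (\<lambda>i e. \<forall>x. R i e x)"
proof -
  obtain p where p: "\<And>l. levels (k # s) l \<Longrightarrow> strat l p"
      "\<And>i e. i \<in> I \<Longrightarrow> sat (M i) e p \<longleftrightarrow> R i (\<lambda>n. e (Suc n)) (e 0)"
    using assms unfolding stratified_def by blast
  define m where "m = max (var_bound p) (length s)"
  \<comment> \<open>From \<open>m\<close> on nothing matters except that the renaming stays injective.\<close>
  define r where "r n = (case n of 0 \<Rightarrow> m | Suc j \<Rightarrow> if j < m then j else Suc j)" for n
  have r: "inj r" by (auto simp: inj_def r_def split: nat.splits if_splits)
  have lev: "levels (k # s) (l(m := int k) \<circ> r)" if "levels s l" for l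
    unfolding levels_def has_level_Cons_iff
  proof (intro allI impI)
    fix n k' assume *: "case n of 0 \<Rightarrow> k = k' | Suc j \<Rightarrow> has_level s j k'"
    show "(l(m := int k) \<circ> r) n = int k'"
    proof (cases n)
      case 0
      then show ?thesis using * by (simp add: r_def)
    next
      case (Suc j)
      then have "has_level s j k'" using * by simp
      moreover from this have "j < m" by (auto simp: m_def has_level_def)
      ultimately show ?thesis using Suc that by (simp add: r_def levels_def)
    qed
  qed
  have sat: "sat (M i) (e(m := a) \<circ> r) p \<longleftrightarrow> R i e a" if "i \<in> I" for i e a
  proof -
    have "sat (M i) (e(m := a) \<circ> r) p = sat (M i) (case_nat a e) p"
      by (rule sat_cong) (auto simp: r_def m_def split: nat.split)
    then show ?thesis using p(2)[OF that] by simp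
  qed
  show ?thesis
  proof (rule stratifiedI)
    fix l assume "levels s l"
    then show "strat l (All m (rename r p))"
      using p(1) lev by (auto simp: strat_rename r)
  next
    fix i e assume "i \<in> I"
    then show "sat (M i) e (All m (rename r p)) \<longleftrightarrow> (\<forall>x. R i e x)"
      using sat by (simp add: sat_rename r)
  qed
qed

lemma stratified_disj [strat_intros]:
  assumes "stratified s P" "stratified s Q" shows "stratified s (\<lambda>i e. P i e \<or> Q i e)"
  by (rule stratified_cong[OF stratified_not[OF stratified_conj[OF
        stratified_not[OF assms(1)] stratified_not[OF assms(2)]]]]) simp

lemma stratified_imp [strat_intros]:
  assumes "stratified s P" "stratified s Q" shows "stratified s (\<lambda>i e. P i e \<longrightarrow> Q i e)"
  by (rule stratified_cong[OF stratified_disj[OF stratified_not[OF assms(1)] assms(2)]]) simp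

lemma stratified_iff [strat_intros]:
  assumes "stratified s P" "stratified s Q" shows "stratified s (\<lambda>i e. P i e \<longleftrightarrow> Q i e)"
  by (rule stratified_cong[OF stratified_conj[OF stratified_imp[OF assms]
        stratified_imp[OF assms(2,1)]]]) blast

lemma stratified_ex [strat_intros]:
  assumes "stratified (k # s) (\<lambda>i e. R i (\<lambda>n. e (Suc n)) (e 0))"
  shows "stratified s (\<lambda>i e. \<exists>x. R i e x)"
  by (rule stratified_cong[OF stratified_not[OF stratified_all[where R = "\<lambda>i e x. \<not> R i e x",
        OF stratified_not[OF assms]]]]) simp

lemma stratified_mem_var:
  assumes "has_level s m k" "has_level s n (Suc k)"
  shows "stratified s (\<lambda>i e. M i (e m) (e n))"
  by (rule stratifiedI[of _ "Mem m n"]) (use assms in \<open>auto simp: levels_def\<close>)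

lemma stratified_eq_var:
  assumes "has_level s m k" "has_level s n k"
  shows "stratified s (\<lambda>i e. e m = e n)"
  by (rule stratifiedI[of _ "Eq m n"]) (use assms in \<open>auto simp: levels_def\<close>)

lemma stratified_term_var [strat_intros]:
  assumes "has_level s n k" shows "stratified_term s k (\<lambda>i e. e n)"
  unfolding stratified_term_def
  by (rule stratified_eq_var) (rule strat_intros assms)+

lemma stratified_insert_level:
  assumes "stratified (k # s) (\<lambda>i e. R i (\<lambda>n. e (Suc n)) (e 0))"
  shows "stratified (k # k' # s) (\<lambda>i e. R i (\<lambda>n. e (Suc (Suc n))) (e 0))"
proof -
  define r where "r n = (case n of 0 \<Rightarrow> 0 | Suc j \<Rightarrow> Suc (Suc j))" for n
  have "stratified (k # k' # s) (\<lambda>i e. R i (\<lambda>n. e (r (Suc n))) (e (r 0)))"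
    by (rule stratified_rename[OF assms])
      (auto simp: inj_def r_def has_level_Cons_iff split: nat.splits)
  then show ?thesis by (simp add: r_def)
qed

text \<open>A term may replace a variable of its own level, since \<open>R (t)\<close> is \<open>\<exists>x. x = t \<and> R x\<close>.\<close>

lemma stratified_subst:
  assumes R: "stratified (k # s) (\<lambda>i e. R i (\<lambda>n. e (Suc n)) (e 0))"
    and t: "stratified_term s k t"
  shows "stratified s (\<lambda>i e. R i e (t i e))"
proof -
  have "stratified s (\<lambda>i e. \<exists>x. x = t i e \<and> R i e x)"
    by (rule stratified_ex stratified_conj R t[unfolded stratified_term_def])+
  then show ?thesis by simp
qed

lemma stratified_term_lift:
  assumes "stratified_term s k t"
  shows "stratified_term (k' # s) k (\<lambda>i e. t i (\<lambda>n. e (Suc n)))"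
  using assms unfolding stratified_term_def by (rule stratified_insert_level)

lemma stratified_extend:
  assumes "stratified s P" shows "stratified (s @ s') P"
  using assms unfolding stratified_def levels_def has_level_def
  by (metis (no_types, lifting) length_append nth_append trans_less_add1)

lemma stratified_subst1:
  assumes P: "stratified [k] (\<lambda>i e. P i (e 0))" and t: "stratified_term s k t"
  shows "stratified s (\<lambda>i e. P i (t i e))"
  by (rule stratified_subst[OF _ t]) (use stratified_extend[OF P, of s] in simp)

lemma stratified_subst2:
  assumes P: "stratified [k, k'] (\<lambda>i e. P i (e 0) (e (Suc 0)))"
    and t: "stratified_term s k t" and t': "stratified_term s k' t'"
  shows "stratified s (\<lambda>i e. P i (t i e) (t' i e))"
  by (rule stratified_subst[OF _ t'], rule stratified_subst[OF _ stratified_term_lift[OF t]])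
    (use stratified_extend[OF P, of s] in simp)

lemma stratified_subst3:
  assumes P: "stratified [k, k', k''] (\<lambda>i e. P i (e 0) (e (Suc 0)) (e (Suc (Suc 0))))"
    and t: "stratified_term s k t" and t': "stratified_term s k' t'"
    and t'': "stratified_term s k'' t''"
  shows "stratified s (\<lambda>i e. P i (t i e) (t' i e) (t'' i e))"
  by (rule stratified_subst[OF _ t''], rule stratified_subst[OF _ stratified_term_lift[OF t']],
      rule stratified_subst[OF _ stratified_term_lift[OF stratified_term_lift[OF t]]])
    (use stratified_extend[OF P, of s] in simp)

lemma stratified_mem [strat_intros]:
  assumes "stratified_term s k t" "stratified_term s (Suc k) u"
  shows "stratified s (\<lambda>i e. M i (t i e) (u i e))"
  by (rule stratified_subst2[where P = M, OF stratified_mem_var assms]) (rule strat_intros)+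

lemma stratified_eq [strat_intros]:
  assumes "stratified_term s k t" "stratified_term s k u"
  shows "stratified s (\<lambda>i e. t i e = u i e)"
  by (rule stratified_subst2[where P = "\<lambda>i. (=)", OF stratified_eq_var assms])
    (rule strat_intros)+

lemma stratified_True [strat_intros]: "stratified s (\<lambda>i e. True)"
  by (rule stratifiedI[of _ "All 0 (Eq 0 0)"]) auto

lemma stratified_False [strat_intros]: "stratified s (\<lambda>i e. False)"
  using stratified_not[OF stratified_True] by simp

lemma stratified_ex1 [strat_intros]:
  assumes R: "stratified (k # s) (\<lambda>i e. R i (\<lambda>n. e (Suc n)) (e 0))"
  shows "stratified s (\<lambda>i e. \<exists>!x. R i e x)"
  unfolding Ex1_def
  by (rule stratified_ex stratified_conj R stratified_all stratified_imp
      stratified_insert_level[where R = R, OF R] strat_intros)+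

text \<open>A closed term can be used at every level at which its definition can be typed, also at different
levels within one predicate.  The rules for \<open>zero\<close>, \<open>Nn\<close> and the set of winning positions below have
this form.\<close>

lemma stratified_term0:
  assumes "stratified_term [] k (\<lambda>i e. t i)" shows "stratified_term s k (\<lambda>i e. t i)"
  using stratified_extend[of "[k]" _ s] assms unfolding stratified_term_def by simp

lemma stratified_term1:
  assumes F: "stratified_term [k1] k (\<lambda>i e. F i (e 0))" and "stratified_term s k1 t"
  shows "stratified_term s k (\<lambda>i e. F i (t i e))"
  using stratified_subst2[where P = "\<lambda>i x y. x = F i y", of k k1 "k # s"
      "\<lambda>i e. e 0" "\<lambda>i e. t i (\<lambda>n. e (Suc n))"] assms
  by (simp add: stratified_term_def[of "[k1]"] stratified_term_def[of s k] stratified_term_lift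
      stratified_term_var has_level_0)

lemma stratified_term2:
  assumes F: "stratified_term [k1, k2] k (\<lambda>i e. F i (e 0) (e (Suc 0)))"
    and "stratified_term s k1 t" "stratified_term s k2 u"
  shows "stratified_term s k (\<lambda>i e. F i (t i e) (u i e))"
  using stratified_subst3[where P = "\<lambda>i x y z. x = F i y z", of k k1 k2 "k # s"
      "\<lambda>i e. e 0" "\<lambda>i e. t i (\<lambda>n. e (Suc n))" "\<lambda>i e. u i (\<lambda>n. e (Suc n))"] assms
  by (simp add: stratified_term_def[of "[k1, k2]"] stratified_term_def[of s k] stratified_term_lift
      stratified_term_var has_level_0)

text \<open>The environment \<open>e\<close> supplies the parameters of the instance of comprehension.\<close>

lemma comprehension_stratified:
  assumes "stratified (k # s) (\<lambda>i e. R i (\<lambda>n. e (Suc n)) (e 0))" "i \<in> I"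
  shows "\<exists>y. \<forall>x. M i x y \<longleftrightarrow> R i e x"
proof -
  interpret NF "M i" using NF_M assms(2) .
  obtain p where p: "\<And>l. levels (k # s) l \<Longrightarrow> strat l p"
      "\<And>e. sat (M i) e p \<longleftrightarrow> R i (\<lambda>n. e (Suc n)) (e 0)"
    using assms unfolding stratified_def by blast
  have "levels (k # s) (\<lambda>n. int ((k # s) ! n))" by (auto simp: levels_def has_level_def)
  then have "stratifiable p" using p(1) by (auto simp: stratifiable_def)
  from comprehension[OF this, of "case_nat undefined e" 0] show ?thesis
    by (simp add: p(2))
qed

text \<open>A set abstract whose predicate is stratified exists in every model of the family, so the equation
\<open>y = setof P\<close> says that \<open>y\<close> and \<open>P\<close> have the same members, which is stratified again.\<close>

lemma stratified_setof [strat_intros]: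
  assumes R: "stratified (k # s) (\<lambda>i e. R i (\<lambda>n. e (Suc n)) (e 0))"
  shows "stratified_term s (Suc k) (\<lambda>i e. nf_structure.setof (M i) (R i e))"
proof -
  have *: "y = nf_structure.setof (M i) (R i e) \<longleftrightarrow> (\<forall>z. M i z y \<longleftrightarrow> R i e z)"
    if i: "i \<in> I" for i e y
  proof -
    interpret NF "M i" using NF_M i .
    obtain y0 where y0: "\<forall>z. M i z y0 \<longleftrightarrow> R i e z"
      using comprehension_stratified[OF R i] by blast
    have "setof (R i e) = y0" unfolding setof_def
      by (rule the_equality) (use y0 extensionality in blast)+
    then show ?thesis using y0 extensionality by blast
  qed
  have "stratified (Suc k # s)
      (\<lambda>i e. \<forall>z. M i z (e 0) \<longleftrightarrow> R i (\<lambda>n. e (Suc n)) z)"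
    by (rule stratified_all stratified_iff stratified_insert_level[where R = R, OF R] strat_intros)+
  then show ?thesis unfolding stratified_term_def by (rule stratified_cong) (simp add: *)
qed

end

section \<open>Levels of the set operations\<close>

context nf_structure
begin

text \<open>In the terminology of Bourbaki, \<open>P\<close> is collectivizing.  This is the condition under which the
definite description in \<open>setof P\<close> is meaningful.\<close>

definition coll :: "('a \<Rightarrow> bool) \<Rightarrow> bool" where
  "coll P \<longleftrightarrow> (\<exists>y. \<forall>x. x \<epsilon> y \<longleftrightarrow> P x)"

definition sub :: "'a \<Rightarrow> 'a \<Rightarrow> bool" where
  "sub x y \<longleftrightarrow> (\<forall>z. z \<epsilon> x \<longrightarrow> z \<epsilon> y)"

definition univ :: 'a where
  "univ = setof (\<lambda>z. True)"

definition inter :: "'a \<Rightarrow> 'a \<Rightarrow> 'a" where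
  "inter x y = setof (\<lambda>z. z \<epsilon> x \<and> z \<epsilon> y)"

definition remove :: "'a \<Rightarrow> 'a \<Rightarrow> 'a" where
  "remove x a = setof (\<lambda>z. z \<epsilon> x \<and> z \<noteq> a)"

definition union :: "'a \<Rightarrow> 'a" where
  "union x = setof (\<lambda>z. \<exists>y. z \<epsilon> y \<and> y \<epsilon> x)"

definition pow :: "'a \<Rightarrow> 'a" where
  "pow x = setof (\<lambda>y. sub y x)"

definition singletons :: "'a \<Rightarrow> 'a" where
  "singletons x = setof (\<lambda>z. \<exists>y. y \<epsilon> x \<and> z = sing y)"

text \<open>Finiteness and equality of cardinality refer to Frege numbers instead of bijections, because pairs
are not available until the universe is known to be infinite.\<close>

definition fin :: "'a \<Rightarrow> bool" where
  "fin x \<longleftrightarrow> (\<exists>n. n \<epsilon> Nn \<and> x \<epsilon> n)"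

definition equi :: "'a \<Rightarrow> 'a \<Rightarrow> bool" where
  "equi x y \<longleftrightarrow> (\<exists>n. n \<epsilon> Nn \<and> x \<epsilon> n \<and> y \<epsilon> n)"

text \<open>In cardinal arithmetic \<open>v = 2\<^sup>u\<close>.  The set \<open>x\<close> is one type below \<open>u\<close> and \<open>v\<close>.\<close>

definition is_log :: "'a \<Rightarrow> 'a \<Rightarrow> bool" where
  "is_log u v \<longleftrightarrow> (\<exists>x. equi u (singletons x) \<and> equi v (pow x))"

text \<open>The least set that contains every position with a move \<open>u\<close> such that all replies \<open>w\<close> to \<open>u\<close>
belong to it.\<close>

definition winning :: 'a where
  "winning = setof (\<lambda>v. \<forall>S. (\<forall>v'. (\<exists>u. is_log u v' \<and> (\<forall>w. is_log w u \<longrightarrow> w \<epsilon> S)) \<longrightarrow> v' \<epsilon> S)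
     \<longrightarrow> v \<epsilon> S)"

text \<open>The union of all values of \<open>f\<close> at \<open>a\<close>.  It agrees with \<open>app f a\<close> when \<open>f\<close> is a function, but is
a set abstract and hence a stratified term for all \<open>f\<close> and \<open>a\<close>.\<close>

definition val :: "'a \<Rightarrow> 'a \<Rightarrow> 'a" where
  "val f a = setof (\<lambda>z. \<exists>b. pair a b \<epsilon> f \<and> z \<epsilon> b)"

definition curry_at :: "'a \<Rightarrow> 'a \<Rightarrow> 'a \<Rightarrow> 'a" where
  "curry_at A f c = setof (\<lambda>q. \<exists>a b. a \<epsilon> A \<and> pair (pair a c) b \<epsilon> f \<and> q = pair a b)"

definition transpose :: "'a \<Rightarrow> 'a \<Rightarrow> 'a \<Rightarrow> 'a" where
  "transpose A X f = setof (\<lambda>p. \<exists>c. c \<epsilon> X \<and> p = pair (sing c) (curry_at A f c))"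

end

context NF_family
begin

lemma strat_empty [strat_intros]: "stratified_term s (Suc k) (\<lambda>i e. nf_structure.empty (M i))"
  by (rule stratified_term0) (unfold nf_structure.empty_def, (rule strat_intros)+)

lemma strat_sing [strat_intros]:
  "stratified_term s k t \<Longrightarrow> stratified_term s (Suc k) (\<lambda>i e. nf_structure.sing (M i) (t i e))"
  by (rule stratified_term1[where F = "\<lambda>i. nf_structure.sing (M i)"])
    (unfold nf_structure.sing_def, (rule strat_intros)+)

lemma strat_un [strat_intros]:
  "stratified_term s (Suc k) t \<Longrightarrow> stratified_term s (Suc k) u \<Longrightarrow>
    stratified_term s (Suc k) (\<lambda>i e. nf_structure.un (M i) (t i e) (u i e))"
  by (rule stratified_term2[where F = "\<lambda>i. nf_structure.un (M i)"])
    (unfold nf_structure.un_def, (rule strat_intros)+)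

lemma strat_remove [strat_intros]:
  "stratified_term s (Suc k) t \<Longrightarrow> stratified_term s k u \<Longrightarrow>
    stratified_term s (Suc k) (\<lambda>i e. nf_structure.remove (M i) (t i e) (u i e))"
  by (rule stratified_term2[where F = "\<lambda>i. nf_structure.remove (M i)"])
    (unfold nf_structure.remove_def, (rule strat_intros)+)

lemma strat_sub [strat_intros]:
  "stratified_term s (Suc k) t \<Longrightarrow> stratified_term s (Suc k) u \<Longrightarrow>
    stratified s (\<lambda>i e. nf_structure.sub (M i) (t i e) (u i e))"
  by (rule stratified_subst2[where P = "\<lambda>i. nf_structure.sub (M i)"])
    (unfold nf_structure.sub_def, (rule strat_intros)+)

lemma strat_union [strat_intros]:
  "stratified_term s (Suc (Suc k)) t \<Longrightarrow>
    stratified_term s (Suc k) (\<lambda>i e. nf_structure.union (M i) (t i e))"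
  by (rule stratified_term1[where F = "\<lambda>i. nf_structure.union (M i)"])
    (unfold nf_structure.union_def, (rule strat_intros)+)

lemma strat_pow [strat_intros]:
  "stratified_term s (Suc k) t \<Longrightarrow>
    stratified_term s (Suc (Suc k)) (\<lambda>i e. nf_structure.pow (M i) (t i e))"
  by (rule stratified_term1[where F = "\<lambda>i. nf_structure.pow (M i)"])
    (unfold nf_structure.pow_def, (rule strat_intros)+)

lemma strat_singletons [strat_intros]:
  "stratified_term s (Suc k) t \<Longrightarrow>
    stratified_term s (Suc (Suc k)) (\<lambda>i e. nf_structure.singletons (M i) (t i e))"
  by (rule stratified_term1[where F = "\<lambda>i. nf_structure.singletons (M i)"])
    (unfold nf_structure.singletons_def, (rule strat_intros)+)

lemma strat_zero [strat_intros]: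
  "stratified_term s (Suc (Suc k)) (\<lambda>i e. nf_structure.zero (M i))"
  by (rule stratified_term0) (unfold nf_structure.zero_def, (rule strat_intros)+)

lemma strat_succ [strat_intros]:
  "stratified_term s (Suc (Suc k)) t \<Longrightarrow>
    stratified_term s (Suc (Suc k)) (\<lambda>i e. nf_structure.succ (M i) (t i e))"
  by (rule stratified_term1[where F = "\<lambda>i. nf_structure.succ (M i)"])
    (unfold nf_structure.succ_def, (rule strat_intros)+)

lemma strat_Nn [strat_intros]:
  "stratified_term s (Suc (Suc (Suc k))) (\<lambda>i e. nf_structure.Nn (M i))"
  by (rule stratified_term0) (unfold nf_structure.Nn_def, (rule strat_intros)+)

lemma strat_fin [strat_intros]:
  "stratified_term s (Suc k) t \<Longrightarrow> stratified s (\<lambda>i e. nf_structure.fin (M i) (t i e))"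
  by (rule stratified_subst1[where P = "\<lambda>i. nf_structure.fin (M i)"])
    (unfold nf_structure.fin_def, (rule strat_intros)+)

lemma strat_equi [strat_intros]:
  "stratified_term s (Suc k) t \<Longrightarrow> stratified_term s (Suc k) u \<Longrightarrow>
    stratified s (\<lambda>i e. nf_structure.equi (M i) (t i e) (u i e))"
  by (rule stratified_subst2[where P = "\<lambda>i. nf_structure.equi (M i)"])
    (unfold nf_structure.equi_def, (rule strat_intros)+)

lemma strat_is_log [strat_intros]:
  "stratified_term s (Suc (Suc k)) t \<Longrightarrow> stratified_term s (Suc (Suc k)) u \<Longrightarrow>
    stratified s (\<lambda>i e. nf_structure.is_log (M i) (t i e) (u i e))"
  by (rule stratified_subst2[where P = "\<lambda>i. nf_structure.is_log (M i)"])
    (unfold nf_structure.is_log_def, (rule strat_intros)+)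

lemma strat_winning [strat_intros]:
  "stratified_term s (Suc (Suc (Suc k))) (\<lambda>i e. nf_structure.winning (M i))"
  by (rule stratified_term0) (unfold nf_structure.winning_def, (rule strat_intros)+)

text \<open>The argument has to lie three levels above the lowest one: its elements are compared with Frege
numbers, whose elements are in turn sets.\<close>

lemma strat_shift [strat_intros]:
  "stratified_term s (Suc (Suc (Suc k))) t \<Longrightarrow>
    stratified_term s (Suc (Suc (Suc k))) (\<lambda>i e. nf_structure.shift (M i) (t i e))"
  by (rule stratified_term1[where F = "\<lambda>i. nf_structure.shift (M i)"])
    (unfold nf_structure.shift_def, (rule strat_intros)+)

lemma strat_pair [strat_intros]:
  "stratified_term s (Suc (Suc (Suc (Suc k)))) t \<Longrightarrow>
   stratified_term s (Suc (Suc (Suc (Suc k)))) u \<Longrightarrow>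
    stratified_term s (Suc (Suc (Suc (Suc k)))) (\<lambda>i e. nf_structure.pair (M i) (t i e) (u i e))"
  by (rule stratified_term2[where F = "\<lambda>i. nf_structure.pair (M i)"])
    (unfold nf_structure.pair_def, (rule strat_intros)+)

lemma strat_prod [strat_intros]:
  "stratified_term s (Suc (Suc (Suc (Suc (Suc k))))) t \<Longrightarrow>
   stratified_term s (Suc (Suc (Suc (Suc (Suc k))))) u \<Longrightarrow>
    stratified_term s (Suc (Suc (Suc (Suc (Suc k))))) (\<lambda>i e. nf_structure.prod (M i) (t i e) (u i e))"
  by (rule stratified_term2[where F = "\<lambda>i. nf_structure.prod (M i)"])
    (unfold nf_structure.prod_def, (rule strat_intros)+)

lemma strat_hom [strat_intros]:
  "stratified_term s (Suc (Suc (Suc (Suc (Suc k))))) f \<Longrightarrow>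
   stratified_term s (Suc (Suc (Suc (Suc (Suc k))))) t \<Longrightarrow>
   stratified_term s (Suc (Suc (Suc (Suc (Suc k))))) u \<Longrightarrow>
    stratified s (\<lambda>i e. f i e \<in> nf_structure.hom (M i) (t i e) (u i e))"
  by (rule stratified_subst3[where P = "\<lambda>i f A B. f \<in> nf_structure.hom (M i) A B"])
    (unfold nf_structure.hom_def mem_Collect_eq, (rule strat_intros)+)

lemma strat_comp [strat_intros]:
  "stratified_term s (Suc (Suc (Suc (Suc (Suc k))))) t \<Longrightarrow>
   stratified_term s (Suc (Suc (Suc (Suc (Suc k))))) u \<Longrightarrow>
    stratified_term s (Suc (Suc (Suc (Suc (Suc k))))) (\<lambda>i e. nf_structure.comp (M i) (t i e) (u i e))"
  by (rule stratified_term2[where F = "\<lambda>i. nf_structure.comp (M i)"])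
    (unfold nf_structure.comp_def, (rule strat_intros)+)

lemma strat_val [strat_intros]:
  "stratified_term s (Suc (Suc (Suc (Suc (Suc k))))) t \<Longrightarrow>
   stratified_term s (Suc (Suc (Suc (Suc k)))) u \<Longrightarrow>
    stratified_term s (Suc (Suc (Suc (Suc k)))) (\<lambda>i e. nf_structure.val (M i) (t i e) (u i e))"
  by (rule stratified_term2[where F = "\<lambda>i. nf_structure.val (M i)"])
    (unfold nf_structure.val_def, (rule strat_intros)+)

end

sublocale NF \<subseteq> NF_family "UNIV :: unit set" "\<lambda>_. mem"
  by unfold_locales

context NF
begin
text \<open>The parameters are bound by object quantifiers, so that matching the conclusion against a concrete
class is higher-order pattern unification.\<close>

lemma coll0: "stratified [k] (\<lambda>_ e. Q (e 0)) \<Longrightarrow> coll Q"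
  using comprehension_stratified[where R = "\<lambda>_ e. Q"] by (auto simp: coll_def)

lemma coll1: "stratified [k, k1] (\<lambda>_ e. Q (e 0) (e (Suc 0))) \<Longrightarrow> \<forall>a. coll (\<lambda>z. Q z a)"
  using comprehension_stratified[where R = "\<lambda>_ e z. Q z (e 0)" and e = "\<lambda>_. a" for a]
  by (auto simp: coll_def)

lemma coll2:
  assumes "stratified [k, k1, k2] (\<lambda>_ e. Q (e 0) (e (Suc 0)) (e (Suc (Suc 0))))"
  shows "\<forall>a b. coll (\<lambda>z. Q z a b)"
proof (intro allI)
  fix a b
  show "coll (\<lambda>z. Q z a b)"
    using comprehension_stratified[where R = "\<lambda>_ e z. Q z (e 0) (e (Suc 0))" and e = "case_nat a (\<lambda>_. b)"] assms
    by (auto simp: coll_def)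
qed

lemma coll3:
  assumes "stratified [k, k1, k2, k3] (\<lambda>_ e. Q (e 0) (e (Suc 0)) (e (Suc (Suc 0))) (e (Suc (Suc (Suc 0)))))"
  shows "\<forall>a b c. coll (\<lambda>z. Q z a b c)"
proof (intro allI)
  fix a b c
  show "coll (\<lambda>z. Q z a b c)"
    using comprehension_stratified[where R = "\<lambda>_ e z. Q z (e 0) (e (Suc 0)) (e (Suc (Suc 0)))" and e = "case_nat a (case_nat b (\<lambda>_. c))"] assms
    by (auto simp: coll_def)
qed

lemma mem_setof: "coll P \<Longrightarrow> z \<epsilon> setof P \<longleftrightarrow> P z"
proof -
  assume "coll P"
  then obtain y where y: "\<forall>x. x \<epsilon> y \<longleftrightarrow> P x" by (auto simp: coll_def)
  have "setof P = y" unfolding setof_def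
    by (rule the_equality) (use y extensionality in blast)+
  then show ?thesis using y by simp
qed

lemma mem_pair: "z \<epsilon> pair a b \<longleftrightarrow> (\<exists>x. x \<epsilon> a \<and> z = shift x) \<or>
                          (\<exists>x. x \<epsilon> b \<and> z = un (shift x) (sing zero))"
proof -
  have "\<forall>a b. coll (\<lambda>z. (\<exists>x. x \<epsilon> a \<and> z = shift x) \<or>
                          (\<exists>x. x \<epsilon> b \<and> z = un (shift x) (sing zero)))"
    by (rule coll2, (rule strat_intros)+)
  then show ?thesis unfolding pair_def by (simp add: mem_setof)
qed

end

section \<open>Elementary set operations\<close>

context nf_structure
begin
abbreviation adjoin :: "'a \<Rightarrow> 'a \<Rightarrow> 'a" where
  "adjoin x a \<equiv> un x (sing a)"
end

context NF
begin

lemma ext_iff: "x = y \<longleftrightarrow> (\<forall>z. z \<epsilon> x \<longleftrightarrow> z \<epsilon> y)"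
  using extensionality by blast

lemma mem_empty [simp]: "\<not> z \<epsilon> empty"
  unfolding empty_def by (subst mem_setof) (rule coll0, (rule strat_intros)+, simp)

lemma mem_univ [simp]: "z \<epsilon> univ"
  unfolding univ_def by (subst mem_setof) (rule coll0, (rule strat_intros)+, simp)

lemma mem_sing [simp]: "z \<epsilon> sing x \<longleftrightarrow> z = x"
proof -
  have "\<forall>x. coll (\<lambda>z. z = x)" by (rule coll1, (rule strat_intros)+)
  then show ?thesis unfolding sing_def by (simp add: mem_setof)
qed

lemma mem_un [simp]: "z \<epsilon> un x y \<longleftrightarrow> z \<epsilon> x \<or> z \<epsilon> y"
proof -
  have "\<forall>x y. coll (\<lambda>z. z \<epsilon> x \<or> z \<epsilon> y)" by (rule coll2, (rule strat_intros)+)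
  then show ?thesis unfolding un_def by (simp add: mem_setof)
qed

lemma mem_inter [simp]: "z \<epsilon> inter x y \<longleftrightarrow> z \<epsilon> x \<and> z \<epsilon> y"
proof -
  have "\<forall>x y. coll (\<lambda>z. z \<epsilon> x \<and> z \<epsilon> y)" by (rule coll2, (rule strat_intros)+)
  then show ?thesis unfolding inter_def by (simp add: mem_setof)
qed

lemma mem_remove [simp]: "z \<epsilon> remove x a \<longleftrightarrow> z \<epsilon> x \<and> z \<noteq> a"
proof -
  have "\<forall>x a. coll (\<lambda>z. z \<epsilon> x \<and> z \<noteq> a)" by (rule coll2, (rule strat_intros)+)
  then show ?thesis unfolding remove_def by (simp add: mem_setof)
qed

lemma mem_union [simp]: "z \<epsilon> union x \<longleftrightarrow> (\<exists>y. z \<epsilon> y \<and> y \<epsilon> x)"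
proof -
  have "\<forall>x. coll (\<lambda>z. \<exists>y. z \<epsilon> y \<and> y \<epsilon> x)" by (rule coll1, (rule strat_intros)+)
  then show ?thesis unfolding union_def by (simp add: mem_setof)
qed

lemma mem_pow [simp]: "z \<epsilon> pow x \<longleftrightarrow> sub z x"
proof -
  have "\<forall>x. coll (\<lambda>z. sub z x)" by (rule coll1, (rule strat_intros)+)
  then show ?thesis unfolding pow_def by (simp add: mem_setof)
qed

lemma mem_singletons [simp]: "z \<epsilon> singletons x \<longleftrightarrow> (\<exists>y. y \<epsilon> x \<and> z = sing y)"
proof -
  have "\<forall>x. coll (\<lambda>z. \<exists>y. y \<epsilon> x \<and> z = sing y)" by (rule coll1, (rule strat_intros)+)
  then show ?thesis unfolding singletons_def by (simp add: mem_setof)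
qed

lemma mem_zero [simp]: "z \<epsilon> zero \<longleftrightarrow> z = empty"
  by (simp add: zero_def)

lemma mem_succ: "z \<epsilon> succ n \<longleftrightarrow> (\<exists>x y. x \<epsilon> n \<and> \<not> y \<epsilon> x \<and> z = adjoin x y)"
proof -
  have "\<forall>n. coll (\<lambda>z. \<exists>x y. x \<epsilon> n \<and> \<not> y \<epsilon> x \<and> z = un x (sing y))"
    by (rule coll1, (rule strat_intros)+)
  then show ?thesis unfolding succ_def by (simp add: mem_setof)
qed

lemma mem_Nn:
  "n \<epsilon> Nn \<longleftrightarrow> (\<forall>J. zero \<epsilon> J \<and> (\<forall>m. m \<epsilon> J \<longrightarrow> succ m \<epsilon> J) \<longrightarrow> n \<epsilon> J)"
  unfolding Nn_def by (subst mem_setof) (rule coll0, (rule strat_intros)+, simp)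

lemma sing_inject [simp]: "sing x = sing y \<longleftrightarrow> x = y"
  by (metis mem_sing)

lemma remove_adjoin: "\<not> a \<epsilon> x \<Longrightarrow> remove (adjoin x a) a = x"
  by (rule extensionality) auto

lemma adjoin_remove: "a \<epsilon> x \<Longrightarrow> adjoin (remove x a) a = x"
  by (rule extensionality) auto

section \<open>Frege numbers and finite sets\<close>

lemma zero_Nn [simp]: "zero \<epsilon> Nn" and succ_Nn [simp]: "n \<epsilon> Nn \<Longrightarrow> succ n \<epsilon> Nn"
  by (auto simp: mem_Nn)

lemma Nn_induct [consumes 1, case_names coll zero succ]:
  assumes "n \<epsilon> Nn" "coll P" "P zero" "\<And>m. m \<epsilon> Nn \<Longrightarrow> P m \<Longrightarrow> P (succ m)"
  shows "P n"
proof -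
  have "n \<epsilon> inter Nn (setof P)"
    using assms(1)[unfolded mem_Nn, rule_format, of "inter Nn (setof P)"] assms(2-)
    by (auto simp: mem_setof)
  then show ?thesis using assms(2) by (simp add: mem_setof)
qed

lemma Nn_cases: "n \<epsilon> Nn \<Longrightarrow> n = zero \<or> (\<exists>m. m \<epsilon> Nn \<and> n = succ m)"
proof (induction rule: Nn_induct)
  case coll
  show ?case by (rule coll0, (rule strat_intros)+)
qed auto

lemma not_empty_succ [simp]: "\<not> empty \<epsilon> succ n"
  by (auto simp: mem_succ ext_iff)

lemma zero_neq_succ [simp]: "zero \<noteq> succ n" "succ n \<noteq> zero"
  using not_empty_succ mem_zero by metis+

lemma remove_mem_Nn: "n \<epsilon> Nn \<Longrightarrow> u \<epsilon> succ n \<Longrightarrow> a \<epsilon> u \<Longrightarrow> remove u a \<epsilon> n"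
proof -
  assume "n \<epsilon> Nn"
  then have "\<forall>u a. u \<epsilon> succ n \<and> a \<epsilon> u \<longrightarrow> remove u a \<epsilon> n"
  proof (induction rule: Nn_induct)
    case coll
    show ?case by (rule coll0, (rule strat_intros)+)
  next
    case zero
    show ?case by (auto simp: mem_succ ext_iff)
  next
    case (succ m)
    show ?case
    proof (intro allI impI)
      fix u a assume *: "u \<epsilon> succ (succ m) \<and> a \<epsilon> u"
      then obtain x b where u: "x \<epsilon> succ m" "\<not> b \<epsilon> x" "u = adjoin x b"
        by (auto simp: mem_succ)
      show "remove u a \<epsilon> succ m"
      proof (cases "a = b")
        case True
        then show ?thesis using u by (simp add: remove_adjoin)
      next
        case False
        then have "a \<epsilon> x" using * u by simp
        then have "remove x a \<epsilon> m" using succ u(1) by blast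
        moreover have "remove u a = adjoin (remove x a) b" using False u by (intro extensionality) auto
        ultimately show ?thesis using u(2) unfolding mem_succ by (metis mem_remove)
      qed
    qed
  qed
  then show "u \<epsilon> succ n \<Longrightarrow> a \<epsilon> u \<Longrightarrow> remove u a \<epsilon> n" by blast
qed

text \<open>Removing an element from a common member leads to a common member of the predecessors.\<close>

lemma Nn_disjoint: "n \<epsilon> Nn \<Longrightarrow> m \<epsilon> Nn \<Longrightarrow> x \<epsilon> n \<Longrightarrow> x \<epsilon> m \<Longrightarrow> n = m"
proof -
  assume "n \<epsilon> Nn"
  then have "\<forall>m x. m \<epsilon> Nn \<and> x \<epsilon> n \<and> x \<epsilon> m \<longrightarrow> n = m"
  proof (induction rule: Nn_induct)
    case coll
    show ?case by (rule coll0, (rule strat_intros)+)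
  next
    case zero
    show ?case using Nn_cases by fastforce
  next
    case (succ n)
    show ?case
    proof (intro allI impI, elim conjE)
      fix m x assume *: "m \<epsilon> Nn" "x \<epsilon> succ n" "x \<epsilon> m"
      then obtain m' where m: "m' \<epsilon> Nn" "m = succ m'"
        using Nn_cases not_empty_succ by (metis mem_zero)
      obtain a where "a \<epsilon> x" using *(2) unfolding mem_succ by (metis mem_un mem_sing)
      then have "remove x a \<epsilon> n" "remove x a \<epsilon> m'"
        using remove_mem_Nn succ(1) m * by auto
      then show "succ n = m" using succ m by blast
    qed
  qed
  then show "m \<epsilon> Nn \<Longrightarrow> x \<epsilon> n \<Longrightarrow> x \<epsilon> m \<Longrightarrow> n = m" by blast
qed

lemma equi_sym: "equi x y \<Longrightarrow> equi y x"
  unfolding equi_def by blast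

lemma equi_trans: "equi x y \<Longrightarrow> equi y z \<Longrightarrow> equi x z"
  unfolding equi_def using Nn_disjoint by blast

lemma equi_refl: "equi x x \<longleftrightarrow> fin x"
  unfolding equi_def fin_def by blast

lemma fin_empty [simp]: "fin empty"
  unfolding fin_def using zero_Nn mem_zero by blast

lemma equi_empty [simp]: "equi empty empty"
  by (simp add: equi_refl)

lemma equi_adjoin:
  "equi x y \<Longrightarrow> \<not> a \<epsilon> x \<Longrightarrow> \<not> b \<epsilon> y \<Longrightarrow> equi (adjoin x a) (adjoin y b)"
  unfolding equi_def mem_succ using succ_Nn mem_succ by blast

lemma fin_adjoin: "fin x \<Longrightarrow> fin (adjoin x a)"
proof (cases "a \<epsilon> x")
  case True
  then have "adjoin x a = x" by (intro extensionality) auto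
  then show "fin x \<Longrightarrow> fin (adjoin x a)" by simp
next
  case False
  then show "fin x \<Longrightarrow> fin (adjoin x a)" using equi_adjoin equi_refl by blast
qed

lemma equi_remove: "equi x y \<Longrightarrow> a \<epsilon> x \<Longrightarrow> b \<epsilon> y \<Longrightarrow> equi (remove x a) (remove y b)"
  unfolding equi_def using remove_mem_Nn Nn_cases mem_zero mem_empty by metis

lemma equi_empty_iff: "equi x empty \<Longrightarrow> x = empty"
  unfolding equi_def using Nn_disjoint zero_Nn mem_zero by blast

lemma fin_induct [consumes 1, case_names coll empty adjoin]:
  assumes "fin x" "coll P" "P empty"
    "\<And>x a. fin x \<Longrightarrow> P x \<Longrightarrow> \<not> a \<epsilon> x \<Longrightarrow> P (adjoin x a)"
  shows "P x"
proof -
  obtain n where n: "n \<epsilon> Nn" "x \<epsilon> n" using assms(1) by (auto simp: fin_def)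
  have *: "\<forall>S. coll (\<lambda>n. \<forall>x. x \<epsilon> n \<longrightarrow> x \<epsilon> S)" by (rule coll1, (rule strat_intros)+)
  have "\<forall>x. x \<epsilon> n \<longrightarrow> x \<epsilon> setof P"
    using n(1)
  proof (induction rule: Nn_induct)
    case coll
    show ?case using * by blast
  next
    case zero
    then show ?case using assms(2,3) by (simp add: mem_setof)
  next
    case (succ m)
    then show ?case using assms(2,4) unfolding mem_setof[OF assms(2)] mem_succ fin_def by blast
  qed
  then show ?thesis using n(2) assms(2) by (simp add: mem_setof)
qed

lemma equi_induct [consumes 1, case_names coll empty adjoin]:
  assumes "equi x y" "coll (\<lambda>n. \<forall>x y. x \<epsilon> n \<and> y \<epsilon> n \<longrightarrow> P x y)" "P empty empty"
    "\<And>x y a b. equi x y \<Longrightarrow> P x y \<Longrightarrow> \<not> a \<epsilon> x \<Longrightarrow> \<not> b \<epsilon> y \<Longrightarrow> P (adjoin x a) (adjoin y b)"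
  shows "P x y"
proof -
  obtain n where n: "n \<epsilon> Nn" "x \<epsilon> n \<and> y \<epsilon> n" using assms(1) by (auto simp: equi_def)
  have "\<forall>x y. x \<epsilon> n \<and> y \<epsilon> n \<longrightarrow> P x y"
    using n(1)
  proof (induction rule: Nn_induct)
    case coll
    show ?case by fact
  next
    case zero
    then show ?case using assms(3) by simp
  next
    case (succ m)
    then show ?case using assms(4) unfolding mem_succ equi_def by blast
  qed
  then show ?thesis using n(2) by blast
qed

lemma fin_sub: "fin y \<Longrightarrow> sub x y \<Longrightarrow> fin x"
proof -
  assume "fin y"
  then have "\<forall>x. sub x y \<longrightarrow> fin x"
  proof (induction rule: fin_induct)
    case coll
    show ?case by (rule coll0, (rule strat_intros)+)
  next
    case empty
    have "x = empty" if "sub x empty" for x using that by (auto simp: sub_def ext_iff)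
    then show ?case using fin_empty by metis
  next
    case (adjoin y a)
    show ?case
    proof (intro allI impI)
      fix x assume x: "sub x (adjoin y a)"
      then have "sub (remove x a) y" by (auto simp: sub_def)
      then have *: "fin (remove x a)" using adjoin by blast
      show "fin x"
      proof (cases "a \<epsilon> x")
        case True
        then show ?thesis using fin_adjoin[OF *, of a] by (simp add: adjoin_remove)
      next
        case False
        then have "remove x a = x" by (intro extensionality) auto
        then show ?thesis using * by simp
      qed
    qed
  qed
  then show "sub x y \<Longrightarrow> fin x" by blast
qed

end

section \<open>Finite cardinal arithmetic in a finite universe\<close>

text \<open>The assumption will be refuted.  Until then it allows cardinals to be compared by induction on
finite sets.\<close>

locale finite_NF = NF +
  assumes fin_all [simp]: "fin x"
begin

lemma equi_self [simp]: "equi x x"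
  by (simp add: equi_refl)

lemma equi_sub_eq: "equi x y \<Longrightarrow> sub x y \<Longrightarrow> x = y"
proof -
  have "fin y" by simp
  then have "\<forall>x. equi x y \<and> sub x y \<longrightarrow> x = y"
  proof (induction rule: fin_induct)
    case coll
    show ?case by (rule coll0, (rule strat_intros)+)
  next
    case empty
    show ?case using equi_empty_iff by blast
  next
    case (adjoin y a)
    show ?case
    proof (intro allI impI, elim conjE)
      fix x assume x: "equi x (adjoin y a)" "sub x (adjoin y a)"
      have IH: "remove x b = y" if "b \<epsilon> x" "sub (remove x b) y" for b
        using equi_remove[OF x(1) that(1), of a] that(2) adjoin by (simp add: remove_adjoin)
      show "x = adjoin y a"
      proof (cases "a \<epsilon> x")
        case True
        then have "remove x a = y" using x(2) by (intro IH) (auto simp: sub_def)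
        then show ?thesis using adjoin_remove[OF True] by simp
      next
        case False
        have "a \<epsilon> adjoin y a" by simp
        then have "x \<noteq> empty"
          using equi_empty_iff[of "adjoin y a"] equi_sym x(1) mem_empty by metis
        then obtain b where b: "b \<epsilon> x" using ext_iff mem_empty by blast
        have "sub x y" using x(2) False by (auto simp: sub_def)
        moreover from this b have "remove x b = y" by (intro IH) (auto simp: sub_def)
        ultimately show ?thesis using b by (auto simp: sub_def)
      qed
    qed
  qed
  then show "equi x y \<Longrightarrow> sub x y \<Longrightarrow> x = y" by blast
qed

lemma equi_sub: "equi x y \<Longrightarrow> sub s x \<Longrightarrow> \<exists>t. sub t y \<and> equi s t"
proof -
  assume "equi x y"
  then have "\<forall>s. sub s x \<longrightarrow> (\<exists>t. sub t y \<and> equi s t)"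
  proof (induction rule: equi_induct)
    case coll
    show ?case by (rule coll0, (rule strat_intros)+)
  next
    case empty
    show ?case using equi_self by blast
  next
    case (adjoin x y a b)
    show ?case
    proof (intro allI impI)
      fix s assume s: "sub s (adjoin x a)"
      then have "sub (remove s a) x" by (auto simp: sub_def)
      then obtain t where t: "sub t y" "equi (remove s a) t" using adjoin by blast
      show "\<exists>t. sub t (adjoin y b) \<and> equi s t"
      proof (cases "a \<epsilon> s")
        case True
        have "\<not> b \<epsilon> t" using t(1) adjoin.hyps(3) by (auto simp: sub_def)
        then have "equi (adjoin (remove s a) a) (adjoin t b)"
          using t(2) by (intro equi_adjoin) auto
        then have "equi s (adjoin t b)" using True by (simp add: adjoin_remove)
        then show ?thesis using t(1) by (intro exI[of _ "adjoin t b"]) (auto simp: sub_def)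
      next
        case False
        then have "remove s a = s" by (intro extensionality) auto
        then show ?thesis using t by (intro exI[of _ t]) (auto simp: sub_def)
      qed
    qed
  qed
  then show "sub s x \<Longrightarrow> \<exists>t. sub t y \<and> equi s t" by blast
qed

lemma equi_comparable:
  "(\<exists>t. sub t y \<and> equi x t) \<or> (\<exists>t. sub t x \<and> equi y t)"
proof -
  have "fin x" by simp
  then have "\<forall>y. (\<exists>t. sub t y \<and> equi x t) \<or> (\<exists>t. sub t x \<and> equi y t)"
  proof (induction rule: fin_induct)
    case coll
    show ?case by (rule coll0, (rule strat_intros)+)
  next
    case empty
    show ?case using equi_empty by (auto simp: sub_def intro!: exI[of _ empty])
  next
    case (adjoin x a)
    show ?case
    proof
      fix y
      consider t where "sub t y" "t \<noteq> y" "equi x t" | "equi x y" | t where "sub t x" "equi y t"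
        using adjoin by blast
      then show "(\<exists>t. sub t y \<and> equi (adjoin x a) t) \<or> (\<exists>t. sub t (adjoin x a) \<and> equi y t)"
      proof cases
        case (1 t)
        then obtain b where "b \<epsilon> y" "\<not> b \<epsilon> t" by (auto simp: ext_iff sub_def)
        then have "sub (adjoin t b) y" "equi (adjoin x a) (adjoin t b)"
          using 1 adjoin.hyps(2) by (auto simp: sub_def intro: equi_adjoin)
        then show ?thesis by blast
      next
        case 2
        then show ?thesis using equi_sym by (intro disjI2 exI[of _ x]) (auto simp: sub_def)
      next
        case (3 t)
        then show ?thesis by (intro disjI2 exI[of _ t]) (auto simp: sub_def)
      qed
    qed
  qed
  then show ?thesis by blast
qed

lemma equi_un:
  "equi x y \<Longrightarrow> equi x' y' \<Longrightarrow> (\<And>z. z \<epsilon> x \<Longrightarrow> \<not> z \<epsilon> x') \<Longrightarrow> (\<And>z. z \<epsilon> y \<Longrightarrow> \<not> z \<epsilon> y')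
   \<Longrightarrow> equi (un x x') (un y y')"
proof -
  assume "equi x' y'"
  then have "\<forall>x y. equi x y \<and> (\<forall>z. z \<epsilon> x \<longrightarrow> \<not> z \<epsilon> x') \<and> (\<forall>z. z \<epsilon> y \<longrightarrow> \<not> z \<epsilon> y')
    \<longrightarrow> equi (un x x') (un y y')"
  proof (induction rule: equi_induct)
    case coll
    show ?case by (rule coll0, (rule strat_intros)+)
  next
    case empty
    have "un x empty = x" for x by (rule extensionality) auto
    then show ?case by simp
  next
    case (adjoin x' y' a b)
    have *: "un x (adjoin x' a) = adjoin (un x x') a" for x x' a by (rule extensionality) auto
    show ?case unfolding * using adjoin by (auto intro!: equi_adjoin)
  qed
  then show "equi x y \<Longrightarrow> (\<And>z. z \<epsilon> x \<Longrightarrow> \<not> z \<epsilon> x') \<Longrightarrow> (\<And>z. z \<epsilon> y \<Longrightarrow> \<not> z \<epsilon> y')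
   \<Longrightarrow> equi (un x x') (un y y')" by blast
qed

text \<open>An injective operation preserves cardinality provided that it does not change the type.  The parameter
\<open>p\<close> may have any level.\<close>

lemma equi_image:
  assumes F: "stratified_term [Suc k, k'] (Suc k) (\<lambda>_ e. F (e 0) (e (Suc 0)))"
    and inj: "\<And>z w. z \<epsilon> x \<Longrightarrow> w \<epsilon> x \<Longrightarrow> F z p = F w p \<Longrightarrow> z = w"
    and im: "\<And>w. w \<epsilon> y \<longleftrightarrow> (\<exists>z. z \<epsilon> x \<and> w = F z p)"
  shows "equi y x"
proof -
  note F' = stratified_term2[where F = "\<lambda>_. F", OF F]
  have "fin x" by simp
  then have "\<forall>p y. (\<forall>z w. z \<epsilon> x \<and> w \<epsilon> x \<and> F z p = F w p \<longrightarrow> z = w) \<and>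
    (\<forall>w. w \<epsilon> y \<longleftrightarrow> (\<exists>z. z \<epsilon> x \<and> w = F z p)) \<longrightarrow> equi y x"
  proof (induction rule: fin_induct)
    case coll
    show ?case by (rule coll0, (rule strat_intros F')+)
  next
    case empty
    show ?case
    proof (intro allI impI, elim conjE)
      fix p y assume "\<forall>w. w \<epsilon> y \<longleftrightarrow> (\<exists>z. z \<epsilon> empty \<and> w = F z p)"
      then have "y = empty" by (intro extensionality) auto
      then show "equi y empty" by simp
    qed
  next
    case (adjoin x a)
    show ?case
    proof (intro allI impI, elim conjE)
      fix p y
      assume inj: "\<forall>z w. z \<epsilon> adjoin x a \<and> w \<epsilon> adjoin x a \<and> F z p = F w p \<longrightarrow> z = w"
        and im: "\<forall>w. w \<epsilon> y \<longleftrightarrow> (\<exists>z. z \<epsilon> adjoin x a \<and> w = F z p)"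
      have mem_y: "w \<epsilon> y \<longleftrightarrow> (\<exists>z. (z \<epsilon> x \<or> z = a) \<and> w = F z p)" for w
        using im by (simp only: mem_un mem_sing)
      have a: "F a p \<epsilon> y" unfolding mem_y by blast
      have neq: "F z p \<noteq> F a p" if "z \<epsilon> x" for z
        using inj[rule_format, of z a] that adjoin.hyps(2) by auto
      have "w \<epsilon> remove y (F a p) \<longleftrightarrow> (\<exists>z. z \<epsilon> x \<and> w = F z p)" for w
      proof
        assume "w \<epsilon> remove y (F a p)"
        then have "w \<epsilon> y" "w \<noteq> F a p" by simp_all
        then show "\<exists>z. z \<epsilon> x \<and> w = F z p" unfolding mem_y by metis
      next
        assume "\<exists>z. z \<epsilon> x \<and> w = F z p"
        then obtain z where z: "z \<epsilon> x" "w = F z p" by (elim exE conjE)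
        then have "w \<epsilon> y" unfolding mem_y by metis
        then show "w \<epsilon> remove y (F a p)" using neq[OF z(1)] z(2) by simp
      qed
      moreover have "z = w" if "z \<epsilon> x" "w \<epsilon> x" "F z p = F w p" for z w
        using inj[rule_format, of z w] that by simp
      ultimately have "equi (remove y (F a p)) x"
        using adjoin.IH[rule_format, of p "remove y (F a p)"] by metis
      then have "equi (adjoin (remove y (F a p)) (F a p)) (adjoin x a)"
        using adjoin.hyps(2) by (intro equi_adjoin) simp_all
      then show "equi y (adjoin x a)" using a by (simp add: adjoin_remove)
    qed
  qed
  from this[rule_format, of p y] show ?thesis using inj im by metis
qed

lemma singletons_adjoin: "singletons (adjoin x a) = adjoin (singletons x) (sing a)"
  by (auto simp: ext_iff[of "singletons _"])

lemma equi_singletons: "equi x y \<Longrightarrow> equi (singletons x) (singletons y)"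
proof (induction rule: equi_induct)
  case coll
  show ?case by (rule coll0, (rule strat_intros)+)
next
  case empty
  show ?case by simp
next
  case (adjoin x y a b)
  then show ?case unfolding singletons_adjoin by (intro equi_adjoin) auto
qed

lemma sub_singletons: "sub t (singletons x) \<Longrightarrow> \<exists>w. sub w x \<and> t = singletons w"
proof (intro exI conjI)
  assume t: "sub t (singletons x)"
  then show "sub (union t) x" by (force simp: sub_def)
  show "t = singletons (union t)"
  proof (rule extensionality)
    fix z
    show "z \<epsilon> t \<longleftrightarrow> z \<epsilon> singletons (union t)"
      unfolding mem_singletons mem_union using t[unfolded sub_def mem_singletons]
      by (smt (verit) mem_sing)
  qed
qed

text \<open>For the converse, compare \<open>x\<close> and \<open>y\<close>: if one is equinumerous with a subset of the other, the
operation maps this subset to a subset of the same size as the whole, hence to the whole.\<close>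

lemma equi_singletons_iff: "equi (singletons x) (singletons y) \<longleftrightarrow> equi x y"
proof -
  have *: "equi x y" if eq: "equi (singletons x) (singletons y)" and t: "sub t y" "equi x t" for x y t
  proof -
    have "equi (singletons t) (singletons y)"
      using eq equi_singletons[OF t(2)] equi_sym equi_trans by blast
    then have "singletons t = singletons y"
      by (rule equi_sub_eq) (use t(1) in \<open>auto simp: sub_def\<close>)
    then have "t = y"
      by (intro extensionality) (metis mem_singletons sing_inject)
    then show ?thesis using t(2) by simp
  qed
  show ?thesis
    using equi_comparable[of y x] equi_singletons *[of x y] *[of y x] equi_sym by blast
qed

text \<open>The power set doubles: the subsets that contain the new element are the old ones with that element
adjoined.\<close>

lemma equi_pow_adjoin: assumes "\<not> a \<epsilon> x"
  shows "\<exists>z. pow (adjoin x a) = un (pow x) z \<and> equi z (pow x) \<and> (\<forall>y. y \<epsilon> z \<longrightarrow> a \<epsilon> y)"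
proof -
  have *: "\<forall>x a. coll (\<lambda>z. \<exists>y. y \<epsilon> pow x \<and> z = adjoin y a)"
    by (rule coll2, (rule strat_intros)+)
  define z where "z = setof (\<lambda>z. \<exists>y. y \<epsilon> pow x \<and> z = adjoin y a)"
  have z: "w \<epsilon> z \<longleftrightarrow> (\<exists>y. y \<epsilon> pow x \<and> w = adjoin y a)" for w
    unfolding z_def using * by (simp add: mem_setof)
  have "equi z (pow x)"
  proof (rule equi_image[where F = "\<lambda>y a. adjoin y a" and p = a])
    show "stratified_term [Suc (Suc 0), Suc 0] (Suc (Suc 0)) (\<lambda>_ e. adjoin (e 0) (e (Suc 0)))"
      by (rule strat_intros)+
  next
    fix y w assume y: "y \<epsilon> pow x" and w: "w \<epsilon> pow x" and eq: "adjoin y a = adjoin w a"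
    have "\<not> a \<epsilon> y" using assms y by (auto simp: sub_def)
    moreover have "\<not> a \<epsilon> w" using assms w by (auto simp: sub_def)
    ultimately show "y = w" using eq remove_adjoin by metis
  next
    show "w \<epsilon> z \<longleftrightarrow> (\<exists>y. y \<epsilon> pow x \<and> w = adjoin y a)" for w by (rule z)
  qed
  moreover have "pow (adjoin x a) = un (pow x) z"
  proof (rule extensionality)
    fix w
    have "sub (remove w a) x" if "sub w (adjoin x a)"
      using that by (auto simp: sub_def)
    then have "sub w (adjoin x a) \<Longrightarrow> a \<epsilon> w \<Longrightarrow> \<exists>y. sub y x \<and> w = adjoin y a"
      using adjoin_remove by metis
    moreover have "sub w x" if "sub w (adjoin x a)" "\<not> a \<epsilon> w"
      using that by (auto simp: sub_def)
    moreover have "sub w (adjoin x a)" if "sub w x \<or> (\<exists>y. sub y x \<and> w = adjoin y a)"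
      using that by (auto simp: sub_def)
    ultimately show "w \<epsilon> pow (adjoin x a) \<longleftrightarrow> w \<epsilon> un (pow x) z"
      unfolding mem_un mem_pow z by blast
  qed
  moreover have "a \<epsilon> w" if "w \<epsilon> z" for w using that unfolding z by auto
  ultimately show ?thesis by (intro exI[of _ z]) simp
qed

lemma equi_pow: "equi x y \<Longrightarrow> equi (pow x) (pow y)"
proof (induction rule: equi_induct)
  case coll
  show ?case by (rule coll0, (rule strat_intros)+)
next
  case empty
  show ?case by simp
next
  case (adjoin x y a b)
  obtain z where z: "pow (adjoin x a) = un (pow x) z" "equi z (pow x)" "\<forall>y. y \<epsilon> z \<longrightarrow> a \<epsilon> y"
    using equi_pow_adjoin[OF adjoin.hyps(2)] by auto
  obtain z' where z': "pow (adjoin y b) = un (pow y) z'" "equi z' (pow y)" "\<forall>x. x \<epsilon> z' \<longrightarrow> b \<epsilon> x"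
    using equi_pow_adjoin[OF adjoin.hyps(3)] by auto
  have "equi z z'" using z(2) z'(2) adjoin.IH equi_sym equi_trans by blast
  then show ?case unfolding z z' using adjoin z(3) z'(3)
    by (intro equi_un) (auto simp: sub_def)
qed

lemma equi_pow_iff: "equi (pow x) (pow y) \<longleftrightarrow> equi x y"
proof -
  have *: "equi x y" if eq: "equi (pow x) (pow y)" and t: "sub t y" "equi x t" for x y t
  proof -
    have "equi (pow t) (pow y)"
      using eq equi_pow[OF t(2)] equi_sym equi_trans by blast
    then have "pow t = pow y"
      by (rule equi_sub_eq) (use t(1) in \<open>auto simp: sub_def\<close>)
    then have "y \<epsilon> pow t" by (simp add: sub_def)
    then have "t = y" using t(1) by (auto simp: sub_def ext_iff)
    then show ?thesis using t(2) by simp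
  qed
  show ?thesis
    using equi_comparable[of y x] equi_pow *[of x y] *[of y x] equi_sym by blast
qed

lemma union_singletons: "union (singletons w) = w"
proof (rule extensionality)
  fix z
  show "z \<epsilon> union (singletons w) \<longleftrightarrow> z \<epsilon> w"
    by simp (metis mem_sing)
qed

text \<open>The operation \<open>z \<mapsto> {\<Union>z}\<close> preserves types and maps the sets of singletons of elements of \<open>x\<close>
bijectively to the singletons of subsets of \<open>x\<close>.\<close>

lemma equi_pow_singletons: "equi (singletons (pow x)) (pow (singletons x))"
proof (rule equi_image[where F = "\<lambda>y p. sing (union y)" and p = empty])
  show "stratified_term [Suc (Suc 0), 0] (Suc (Suc 0)) (\<lambda>_ e. sing (union (e 0)))"
    by (rule strat_intros)+
next
  fix z w
  assume "z \<epsilon> pow (singletons x)" "w \<epsilon> pow (singletons x)"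
    and eq: "sing (union z) = sing (union w)"
  then obtain z' w' where "z = singletons z'" "w = singletons w'"
    using sub_singletons mem_pow by blast
  then show "z = w" using eq by (simp add: union_singletons)
next
  fix w
  have "w \<epsilon> singletons (pow x) \<longleftrightarrow> (\<exists>y. sub y x \<and> w = sing y)"
    by (simp only: mem_singletons mem_pow)
  also have "\<dots> \<longleftrightarrow> (\<exists>z. sub z (singletons x) \<and> w = sing (union z))"
  proof
    assume "\<exists>y. sub y x \<and> w = sing y"
    then obtain y where y: "sub y x" "w = sing y" by blast
    have "sub (singletons y) (singletons x)"
      using y(1) unfolding sub_def mem_singletons by blast
    moreover have "w = sing (union (singletons y))" unfolding y(2) union_singletons ..
    ultimately show "\<exists>z. sub z (singletons x) \<and> w = sing (union z)"
      by (intro exI[of _ "singletons y"] conjI)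
  next
    assume "\<exists>z. sub z (singletons x) \<and> w = sing (union z)"
    then obtain z where z: "sub z (singletons x)" "w = sing (union z)" by blast
    obtain v where v: "sub v x" "z = singletons v" using sub_singletons[OF z(1)] by blast
    have "w = sing v" unfolding z(2) v(2) union_singletons ..
    then show "\<exists>y. sub y x \<and> w = sing y" using v(1) by blast
  qed
  finally show "w \<epsilon> singletons (pow x) \<longleftrightarrow> (\<exists>z. z \<epsilon> pow (singletons x) \<and> w = sing (union z))"
    by (simp only: mem_pow)
qed

end

section \<open>The universe is infinite\<close>

context finite_NF
begin

lemma is_log_equi: "is_log u v \<Longrightarrow> equi v v' \<Longrightarrow> is_log u v'"
  unfolding is_log_def using equi_sym equi_trans by blast

text \<open>Logarithms are unique up to equinumerosity.\<close>

lemma is_log_pow_iff: "is_log u (pow x) \<longleftrightarrow> equi u (singletons x)"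
  unfolding is_log_def using equi_pow_iff equi_singletons_iff equi_trans equi_sym equi_self by metis

text \<open>The singletons of elements of \<open>x\<close> are subsets of \<open>x\<close>, and the empty set is a further subset.\<close>

lemma is_log_less:
  assumes "is_log u v"
  shows "\<exists>t. sub t v \<and> t \<noteq> v \<and> equi u t"
proof -
  obtain x where x: "equi u (singletons x)" "equi v (pow x)"
    using assms unfolding is_log_def by blast
  have sub: "sub (singletons x) (pow x)" by (auto simp: sub_def)
  have "empty \<epsilon> pow x" by (simp add: sub_def)
  moreover have "\<not> empty \<epsilon> singletons x"
    unfolding mem_singletons using mem_sing mem_empty by metis
  ultimately have neq: "singletons x \<noteq> pow x" by metis
  obtain t where t: "sub t v" "equi (singletons x) t"
    using equi_sub[OF equi_sym[OF x(2)] sub] by blast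
  have "t \<noteq> v"
  proof
    assume "t = v"
    then have "equi (singletons x) (pow x)" using t(2) x(2) equi_trans by blast
    then show False using equi_sub_eq sub neq by blast
  qed
  then show ?thesis using t x(1) equi_trans by blast
qed

text \<open>A logarithm of \<open>v\<close> is equinumerous with a proper subset of \<open>v\<close>, so induction on finite sets proves
\<open>K\<close> for everything that is equinumerous with a subset of a given set.\<close>

lemma is_log_induct [consumes 0, case_names coll step]:
  assumes "coll K" "\<And>v. (\<And>u. is_log u v \<Longrightarrow> K u) \<Longrightarrow> K v"
  shows "K v"
proof -
  have *: "\<forall>S. coll (\<lambda>x. \<forall>t v. sub t x \<and> equi v t \<longrightarrow> v \<epsilon> S)"
    by (rule coll1, (rule strat_intros)+)
  have "fin v" by simp
  then have "\<forall>t w. sub t v \<and> equi w t \<longrightarrow> w \<epsilon> setof K"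
  proof (induction rule: fin_induct)
    case coll
    show ?case using * by (rule allE)
  next
    case empty
    show ?case
    proof (intro allI impI, elim conjE)
      fix t w assume t: "sub t empty" "equi w t"
      have "\<not> is_log u w" for u
      proof
        assume "is_log u w"
        then obtain s where s: "sub s t" "s \<noteq> t" using is_log_less[OF is_log_equi[OF _ t(2)]] by metis
        have "s = t" by (rule extensionality) (use s(1) t(1) in \<open>simp add: sub_def\<close>)
        then show False using s(2) by simp
      qed
      then have "K w" using assms(2)[of w] by metis
      then show "w \<epsilon> setof K" using assms(1) by (simp add: mem_setof)
    qed
  next
    case (adjoin x a)
    show ?case
    proof (intro allI impI, elim conjE)
      fix t w assume t: "sub t (adjoin x a)" "equi w t"
      have "K u" if u: "is_log u w" for u
      proof -
        obtain s where s: "sub s t" "s \<noteq> t" "equi u s"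
          using is_log_less[OF is_log_equi[OF u t(2)]] by (elim exE conjE)
        obtain b where b: "b \<epsilon> t" "\<not> b \<epsilon> s"
          using s(1,2) extensionality unfolding sub_def by metis
        have s_sub: "sub s (remove (adjoin x a) b)"
          using s(1) t(1) b(2) unfolding sub_def mem_remove by blast
        have "b \<epsilon> adjoin x a" using b(1) t(1) unfolding sub_def by blast
        then have "equi (remove (adjoin x a) b) (remove (adjoin x a) a)"
          by (intro equi_remove) simp_all
        then have "equi (remove (adjoin x a) b) x"
          using remove_adjoin[OF adjoin.hyps(2)] by simp
        from equi_sub[OF this s_sub] obtain r where r: "sub r x" "equi s r" by (elim exE conjE)
        have "u \<epsilon> setof K"
          using adjoin.IH[rule_format, of r u] r(1) equi_trans[OF s(3) r(2)] by simp
        then show ?thesis using assms(1) by (simp add: mem_setof)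
      qed
      then have "K w" by (rule assms(2))
      then show "w \<epsilon> setof K" using assms(1) by (simp add: mem_setof)
    qed
  qed
  from this[rule_format, of v v] have "v \<epsilon> setof K" by (simp add: sub_def)
  then show ?thesis using assms(1) by (simp add: mem_setof)
qed

lemma winning_step:
  assumes "is_log u v" "\<And>w. is_log w u \<Longrightarrow> w \<epsilon> winning"
  shows "v \<epsilon> winning"
proof -
  have c: "coll (\<lambda>v. \<forall>S. (\<forall>v'. (\<exists>u. is_log u v' \<and> (\<forall>w. is_log w u \<longrightarrow> w \<epsilon> S)) \<longrightarrow> v' \<epsilon> S) \<longrightarrow> v \<epsilon> S)"
    by (rule coll0, (rule strat_intros)+)
  show ?thesis
    unfolding winning_def mem_setof[OF c]
  proof (intro allI impI)
    fix S assume S: "\<forall>v'. (\<exists>u. is_log u v' \<and> (\<forall>w. is_log w u \<longrightarrow> w \<epsilon> S)) \<longrightarrow> v' \<epsilon> S"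
    have "w \<epsilon> S" if "is_log w u" for w
      by (rule assms(2)[OF that, unfolded winning_def mem_setof[OF c], THEN spec[of _ S], THEN mp, OF S])
    then show "v \<epsilon> S" using S assms(1) by blast
  qed
qed

lemma winning_cases:
  assumes "v \<epsilon> winning"
  shows "\<exists>u. is_log u v \<and> (\<forall>w. is_log w u \<longrightarrow> w \<epsilon> winning)"
proof -
  have c: "coll (\<lambda>v. \<forall>S. (\<forall>v'. (\<exists>u. is_log u v' \<and> (\<forall>w. is_log w u \<longrightarrow> w \<epsilon> S)) \<longrightarrow> v' \<epsilon> S) \<longrightarrow> v \<epsilon> S)"
    by (rule coll0, (rule strat_intros)+)
  have c': "coll (\<lambda>v. \<exists>u. is_log u v \<and> (\<forall>w. is_log w u \<longrightarrow> w \<epsilon> winning))"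
    by (rule coll0, (rule strat_intros)+)
  define S where "S = setof (\<lambda>v. \<exists>u. is_log u v \<and> (\<forall>w. is_log w u \<longrightarrow> w \<epsilon> winning))"
  have S: "v \<epsilon> S \<longleftrightarrow> (\<exists>u. is_log u v \<and> (\<forall>w. is_log w u \<longrightarrow> w \<epsilon> winning))" for v
    unfolding S_def by (rule mem_setof[OF c'])
  have "v' \<epsilon> S" if "\<exists>u. is_log u v' \<and> (\<forall>w. is_log w u \<longrightarrow> w \<epsilon> S)" for v'
  proof -
    from that obtain u where u: "is_log u v'" "\<forall>w. is_log w u \<longrightarrow> w \<epsilon> S" by blast
    have "w \<epsilon> winning" if "is_log w u" for w
    proof -
      from u(2) that obtain u' where "is_log u' w" "\<forall>w'. is_log w' u' \<longrightarrow> w' \<epsilon> winning"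
        unfolding S by blast
      then show ?thesis using winning_step by blast
    qed
    then show ?thesis unfolding S using u(1) by blast
  qed
  then have "\<forall>v'. (\<exists>u. is_log u v' \<and> (\<forall>w. is_log w u \<longrightarrow> w \<epsilon> S)) \<longrightarrow> v' \<epsilon> S" by blast
  then have "v \<epsilon> S" by (rule assms[unfolded winning_def mem_setof[OF c], THEN spec[of _ S], THEN mp])
  then show ?thesis unfolding S .
qed

text \<open>The two halves of determinacy, each by induction along logarithms: from a lost position every move
leads to a won one, and from a won position some move leads to a lost one.\<close>

lemma winning_iff: "v \<epsilon> winning \<longleftrightarrow> (\<exists>u. is_log u v \<and> \<not> u \<epsilon> winning)"
proof -
  have 1: "\<forall>w. is_log w v \<longrightarrow> w \<epsilon> winning" if "\<not> v \<epsilon> winning" for v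
  proof -
    have "\<not> v \<epsilon> winning \<longrightarrow> (\<forall>w. is_log w v \<longrightarrow> w \<epsilon> winning)"
    proof (induction v rule: is_log_induct)
      case coll
      show ?case by (rule coll0, (rule strat_intros)+)
    next
      case (step v)
      show ?case
      proof (intro allI impI)
        fix w assume "\<not> v \<epsilon> winning" "is_log w v"
        then obtain x where x: "is_log x w" "\<not> x \<epsilon> winning" using winning_step by blast
        show "w \<epsilon> winning"
        proof (rule ccontr)
          assume "\<not> w \<epsilon> winning"
          then show False using step[OF \<open>is_log w v\<close>] x by blast
        qed
      qed
    qed
    then show ?thesis using that by blast
  qed
  have 2: "\<exists>u. is_log u v \<and> \<not> u \<epsilon> winning" if "v \<epsilon> winning" for v
  proof -
    have "v \<epsilon> winning \<longrightarrow> (\<exists>u. is_log u v \<and> \<not> u \<epsilon> winning)"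
    proof (induction v rule: is_log_induct)
      case coll
      show ?case by (rule coll0, (rule strat_intros)+)
    next
      case (step v)
      show ?case
      proof
        assume "v \<epsilon> winning"
        then obtain u where u: "is_log u v" "\<forall>w. is_log w u \<longrightarrow> w \<epsilon> winning"
          using winning_cases by blast
        have "\<not> u \<epsilon> winning" using step[OF u(1)] u(2) by blast
        then show "\<exists>u. is_log u v \<and> \<not> u \<epsilon> winning" using u(1) by blast
      qed
    qed
    then show ?thesis using that by blast
  qed
  show ?thesis using 1 2 winning_step by blast
qed

lemma winning_equi: "equi v v' \<Longrightarrow> v \<epsilon> winning \<longleftrightarrow> v' \<epsilon> winning"
  using winning_iff is_log_equi equi_sym by meson

text \<open>The only move from \<open>pow x\<close> leads, up to equinumerosity, to \<open>singletons x\<close>.\<close>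

lemma winning_pow: "pow x \<epsilon> winning \<longleftrightarrow> \<not> singletons x \<epsilon> winning"
  unfolding winning_iff[of "pow x"] is_log_pow_iff using winning_equi equi_self by blast

lemma is_log_singletons: "is_log u v \<Longrightarrow> is_log (singletons u) (singletons v)"
proof -
  assume "is_log u v"
  then obtain x where "equi u (singletons x)" "equi v (pow x)" unfolding is_log_def by blast
  then have "equi (singletons u) (singletons (singletons x))"
    "equi (singletons v) (pow (singletons x))"
    using equi_singletons equi_pow_singletons equi_trans by blast+
  then show ?thesis unfolding is_log_def by blast
qed

lemma equi_sandwich:
  assumes "equi x s" "sub s y" "equi y z" "sub z x" shows "z = x"
proof -
  obtain r where r: "sub r z" "equi s r" using equi_sub assms(2,3) by blast
  have "sub r x" using r(1) assms(4) unfolding sub_def by blast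
  moreover have "equi r x" using r(2) assms(1) equi_trans equi_sym by blast
  ultimately have "r = x" using equi_sub_eq by blast
  then show ?thesis using r(1) assms(4) unfolding sub_def by (intro extensionality) blast
qed

lemma pow_univ: "pow univ = univ"
  by (rule extensionality) (simp add: sub_def)

text \<open>If \<open>singletons v\<close> is equinumerous with \<open>pow x\<close>, then \<open>x\<close> cannot have more elements than
\<open>singletons univ\<close>: otherwise \<open>pow x\<close> would have more elements than \<open>pow (singletons univ)\<close>, which is
of the size of \<open>singletons (pow univ) = singletons univ\<close>.  Hence \<open>x\<close> itself has the size of a set of
singletons, and one level of singletons can be cancelled throughout.\<close>

lemma is_log_of_singletons:
  assumes "is_log u' (singletons v)"
  shows "\<exists>u. is_log u v \<and> equi u' (singletons u)"
proof -
  obtain x where x: "equi u' (singletons x)" "equi (singletons v) (pow x)"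
    using assms unfolding is_log_def by blast
  have v: "sub (singletons v) (singletons univ)" by (auto simp: sub_def)
  have "\<exists>w. equi x (singletons w)"
  proof -
    consider t where "sub t (singletons univ)" "equi x t"
      | t where "sub t x" "equi (singletons univ) t"
      using equi_comparable by blast
    then show ?thesis
    proof cases
      case (1 t)
      then show ?thesis using sub_singletons by blast
    next
      case (2 t)
      have "equi (singletons univ) (pow (singletons univ))"
        using equi_pow_singletons[of univ] by (simp only: pow_univ)
      then have "equi (singletons univ) (pow t)"
        using equi_pow[OF 2(2)] equi_trans by blast
      moreover have "sub (pow t) (pow x)" using 2(1) by (auto simp: sub_def)
      ultimately have "pow t = pow x" using equi_sandwich equi_sym[OF x(2)] v by blast
      then have "x \<epsilon> pow t" by (simp add: sub_def)
      then have "t = x" using 2(1) unfolding mem_pow sub_def by (intro extensionality) blast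
      then show ?thesis using 2(2) equi_sym by blast
    qed
  qed
  then obtain w where w: "equi x (singletons w)" by (rule exE)
  have "equi (singletons v) (singletons (pow w))"
    using x(2) equi_pow[OF w] equi_pow_singletons[of w] equi_trans equi_sym by blast
  then have "equi v (pow w)" unfolding equi_singletons_iff .
  then have "is_log (singletons w) v" unfolding is_log_def using equi_self by blast
  moreover have "equi u' (singletons (singletons w))"
    using x(1) equi_singletons[OF w] equi_trans by blast
  ultimately show ?thesis by blast
qed

text \<open>The two sides speak of positions of different types, but \<open>winning\<close> is a closed term and can be used
at both levels, so the equivalence is stratified and induction applies.\<close>

lemma winning_singletons: "singletons v \<epsilon> winning \<longleftrightarrow> v \<epsilon> winning"
proof (induction v rule: is_log_induct)
  case coll
  show ?case by (rule coll0, (rule strat_intros)+)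
next
  case (step v)
  have "singletons v \<epsilon> winning \<longleftrightarrow> (\<exists>u. is_log u (singletons v) \<and> \<not> u \<epsilon> winning)"
    by (rule winning_iff)
  also have "\<dots> \<longleftrightarrow> (\<exists>u. is_log u v \<and> \<not> singletons u \<epsilon> winning)"
  proof
    assume "\<exists>u. is_log u (singletons v) \<and> \<not> u \<epsilon> winning"
    then obtain u' where u': "is_log u' (singletons v)" "\<not> u' \<epsilon> winning" by blast
    obtain u where u: "is_log u v" "equi u' (singletons u)" using is_log_of_singletons[OF u'(1)] by blast
    then show "\<exists>u. is_log u v \<and> \<not> singletons u \<epsilon> winning" using u'(2) winning_equi[OF u(2)] by blast
  next
    assume "\<exists>u. is_log u v \<and> \<not> singletons u \<epsilon> winning"
    then show "\<exists>u. is_log u (singletons v) \<and> \<not> u \<epsilon> winning" using is_log_singletons by blast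
  qed
  also have "\<dots> \<longleftrightarrow> (\<exists>u. is_log u v \<and> \<not> u \<epsilon> winning)"
    using step by blast
  also have "\<dots> \<longleftrightarrow> v \<epsilon> winning"
    by (rule winning_iff[symmetric])
  finally show ?case .
qed

lemma finite_NF_inconsistent: False
  using winning_pow[of univ] winning_singletons[of univ] by (simp add: pow_univ)

end

context NF
begin

lemma not_fin_univ: "\<not> fin univ"
proof
  assume "fin univ"
  then have "fin x" for x using fin_sub[of univ x] by (simp add: sub_def)
  then interpret finite_NF by unfold_locales
  show False by (rule finite_NF_inconsistent)
qed

text \<open>An empty Frege number could only arise as the successor of a number that contains the universe.\<close>

lemma Nn_nonempty: "n \<epsilon> Nn \<Longrightarrow> \<exists>x. x \<epsilon> n"
proof (induction rule: Nn_induct)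
  case coll
  show ?case by (rule coll0, (rule strat_intros)+)
next
  case zero
  show ?case by simp
next
  case (succ n)
  then obtain x where x: "x \<epsilon> n" by blast
  then have "fin x" using succ(1) unfolding fin_def by blast
  then have "x \<noteq> univ" using not_fin_univ by blast
  then obtain y where "\<not> y \<epsilon> x" unfolding ext_iff using mem_univ by blast
  then show ?case unfolding mem_succ using x by blast
qed

lemma succ_inject:
  assumes "m \<epsilon> Nn" "n \<epsilon> Nn" "succ m = succ n"
  shows "m = n"
proof -
  obtain x where x: "x \<epsilon> succ m" using Nn_nonempty succ_Nn assms(1) by blast
  then have "x \<noteq> empty" using not_empty_succ by blast
  then obtain a where "a \<epsilon> x" unfolding ext_iff using mem_empty by blast
  then have "remove x a \<epsilon> m" "remove x a \<epsilon> n" using remove_mem_Nn assms x by auto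
  then show ?thesis using Nn_disjoint assms by blast
qed

section \<open>Quine pairs\<close>

lemma mem_shift:
  "z \<epsilon> shift x \<longleftrightarrow> (z \<epsilon> x \<and> \<not> z \<epsilon> Nn) \<or> (\<exists>n. n \<epsilon> x \<and> n \<epsilon> Nn \<and> z = succ n)"
proof -
  have "\<forall>x. coll (\<lambda>z. (z \<epsilon> x \<and> \<not> z \<epsilon> Nn) \<or> (\<exists>n. n \<epsilon> x \<and> n \<epsilon> Nn \<and> z = succ n))"
    by (rule coll1, (rule strat_intros)+)
  then show ?thesis unfolding shift_def by (simp add: mem_setof)
qed

lemma zero_not_shift: "\<not> zero \<epsilon> shift x"
  unfolding mem_shift using zero_Nn zero_neq_succ by blast

text \<open>Membership in \<open>x\<close> can be read off from \<open>shift x\<close>, because incrementing the natural numbers among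
the elements is injective.\<close>

lemma mem_iff_shift: "z \<epsilon> x \<longleftrightarrow> (if z \<epsilon> Nn then succ z else z) \<epsilon> shift x"
proof (cases "z \<epsilon> Nn")
  case True
  then have "succ z \<epsilon> shift x \<longleftrightarrow> z \<epsilon> x"
    unfolding mem_shift using succ_inject succ_Nn by metis
  then show ?thesis using True by simp
next
  case False
  then have "z \<epsilon> shift x \<longleftrightarrow> z \<epsilon> x"
    unfolding mem_shift using succ_Nn by metis
  then show ?thesis using False by simp
qed

lemma shift_inject: "shift x = shift y \<Longrightarrow> x = y"
  using extensionality mem_iff_shift by metis

lemma adjoin_shift_inject: "adjoin (shift x) zero = adjoin (shift y) zero \<Longrightarrow> x = y"
  using remove_adjoin[OF zero_not_shift] shift_inject by metis

lemma shift_neq_adjoin: "shift x \<noteq> adjoin (shift y) zero"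
proof
  assume "shift x = adjoin (shift y) zero"
  moreover have "zero \<epsilon> adjoin (shift y) zero" by simp
  ultimately show False using zero_not_shift by metis
qed

text \<open>The components are recovered as \<open>{x. shift x \<in> p}\<close> and \<open>{x. shift x \<union> {0} \<in> p}\<close>; the two kinds
of elements cannot be confused because \<open>zero\<close> is not in the range of the increment.\<close>

lemma pair_inject [simp]: "pair a b = pair c d \<longleftrightarrow> a = c \<and> b = d"
proof
  have fst: "x \<epsilon> a \<longleftrightarrow> shift x \<epsilon> pair a b" for x a b
    unfolding mem_pair using shift_inject shift_neq_adjoin by metis
  have snd: "x \<epsilon> b \<longleftrightarrow> adjoin (shift x) zero \<epsilon> pair a b" for x a b
    unfolding mem_pair using adjoin_shift_inject shift_neq_adjoin by metis
  assume eq: "pair a b = pair c d"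
  have "z \<epsilon> a \<longleftrightarrow> z \<epsilon> c" for z
    using fst[of z a b] fst[of z c d] unfolding eq by blast
  then have "a = c" by (rule extensionality)
  have "z \<epsilon> b \<longleftrightarrow> z \<epsilon> d" for z
    using snd[where x = z and a = a and b = b] snd[where x = z and a = c and b = d]
    unfolding eq by blast
  then have "b = d" by (rule extensionality)
  with \<open>a = c\<close> show "a = c \<and> b = d" ..
qed simp

end

context NF
begin

section \<open>Functions and composition\<close>

lemma mem_prod: "p \<epsilon> prod A B \<longleftrightarrow> (\<exists>a b. a \<epsilon> A \<and> b \<epsilon> B \<and> p = pair a b)"
proof -
  have "\<forall>A B. coll (\<lambda>p. \<exists>a b. a \<epsilon> A \<and> b \<epsilon> B \<and> p = pair a b)"
    by (rule coll2, (rule strat_intros)+)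
  then show ?thesis unfolding prod_def by (simp add: mem_setof)
qed

lemma pair_mem_prod [simp]: "pair a b \<epsilon> prod A B \<longleftrightarrow> a \<epsilon> A \<and> b \<epsilon> B"
  unfolding mem_prod by auto

lemma hom_iff:
  "f \<in> hom A B \<longleftrightarrow> (\<forall>p. p \<epsilon> f \<longrightarrow> (\<exists>a b. a \<epsilon> A \<and> b \<epsilon> B \<and> p = pair a b)) \<and>
    (\<forall>a. a \<epsilon> A \<longrightarrow> (\<exists>!b. pair a b \<epsilon> f))"
  unfolding hom_def mem_prod mem_Collect_eq ..

lemma app_eqI: "f \<in> hom A B \<Longrightarrow> a \<epsilon> A \<Longrightarrow> pair a b \<epsilon> f \<Longrightarrow> app f a = b"
  unfolding hom_iff app_def by (elim conjE) (rule the1_equality, blast)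

lemma pair_app_mem: "f \<in> hom A B \<Longrightarrow> a \<epsilon> A \<Longrightarrow> pair a (app f a) \<epsilon> f"
  unfolding hom_iff app_def by (elim conjE) (rule theI', blast)

lemma pair_mem_hom_iff: "f \<in> hom A B \<Longrightarrow> pair a b \<epsilon> f \<longleftrightarrow> a \<epsilon> A \<and> b = app f a"
proof
  assume f: "f \<in> hom A B" and ab: "pair a b \<epsilon> f"
  have "a \<epsilon> A" using f[unfolded hom_iff, THEN conjunct1, rule_format, OF ab] by auto
  then show "a \<epsilon> A \<and> b = app f a" using app_eqI f ab by blast
qed (use pair_app_mem in blast)

lemma app_mem: "f \<in> hom A B \<Longrightarrow> a \<epsilon> A \<Longrightarrow> app f a \<epsilon> B"
proof -
  assume f: "f \<in> hom A B" and a: "a \<epsilon> A"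
  then obtain a' b where "b \<epsilon> B" "pair a (app f a) = pair a' b"
    using f[unfolded hom_iff, THEN conjunct1, rule_format, OF pair_app_mem[OF f a]] by (elim exE conjE)
  then show "app f a \<epsilon> B" by (metis pair_inject)
qed

lemma mem_hom_cases: "f \<in> hom A B \<Longrightarrow> p \<epsilon> f \<longleftrightarrow> (\<exists>a. a \<epsilon> A \<and> p = pair a (app f a))"
proof
  assume f: "f \<in> hom A B"
  show "\<exists>a. a \<epsilon> A \<and> p = pair a (app f a)" if p: "p \<epsilon> f"
  proof -
    obtain a b where ab: "p = pair a b"
      using f[unfolded hom_iff, THEN conjunct1, rule_format, OF p] by (elim exE conjE)
    then show ?thesis using p pair_mem_hom_iff[OF f, of a b] by simp
  qed
  show "p \<epsilon> f" if "\<exists>a. a \<epsilon> A \<and> p = pair a (app f a)"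
    using that pair_app_mem[OF f] by auto
qed

lemma hom_eqI:
  assumes "f \<in> hom A B" "g \<in> hom A C" "\<And>a. a \<epsilon> A \<Longrightarrow> app f a = app g a"
  shows "f = g"
  by (rule extensionality) (use assms(3) in \<open>auto simp: mem_hom_cases[OF assms(1)] mem_hom_cases[OF assms(2)]\<close>)

text \<open>The functions to be constructed are given by graphs \<open>{(s x, t x) : Q x}\<close>.  The index \<open>x\<close> need not be an
element of the structure: for maps on a product it is a HOL pair.\<close>

lemma graph_hom:
  fixes s t :: "'b \<Rightarrow> 'a"
  assumes f: "\<And>p. p \<epsilon> f \<longleftrightarrow> (\<exists>x. Q x \<and> p = pair (s x) (t x))"
    and A: "\<And>a. a \<epsilon> A \<longleftrightarrow> (\<exists>x. Q x \<and> a = s x)"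
    and B: "\<And>x. Q x \<Longrightarrow> t x \<epsilon> B"
    and inj: "\<And>x y. Q x \<Longrightarrow> Q y \<Longrightarrow> s x = s y \<Longrightarrow> t x = t y"
  shows "f \<in> hom A B" and "\<And>x. Q x \<Longrightarrow> app f (s x) = t x"
proof -
  have pair: "pair a b \<epsilon> f \<longleftrightarrow> (\<exists>x. Q x \<and> a = s x \<and> b = t x)" for a b
    unfolding f by simp
  show f_hom: "f \<in> hom A B"
    unfolding hom_iff
  proof (intro conjI allI impI)
    fix p assume "p \<epsilon> f"
    then obtain x where "Q x" "p = pair (s x) (t x)" unfolding f by blast
    then show "\<exists>a b. a \<epsilon> A \<and> b \<epsilon> B \<and> p = pair a b" using A B by blast
  next
    fix a assume "a \<epsilon> A"
    then obtain x where x: "Q x" "a = s x" unfolding A by blast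
    show "\<exists>!b. pair a b \<epsilon> f"
    proof (rule ex1I[of _ "t x"])
      show "pair a (t x) \<epsilon> f" unfolding pair using x by blast
      show "b = t x" if "pair a b \<epsilon> f" for b
        using that x inj unfolding pair by blast
    qed
  qed
  fix x assume "Q x"
  then show "app f (s x) = t x"
    by (intro app_eqI[OF f_hom]) (unfold A pair, blast+)
qed

text \<open>Graphs defined through \<open>app\<close> are rewritten with \<open>val\<close> whenever their existence as sets is at stake.\<close>

lemma val_app:
  assumes "f \<in> hom A B" "a \<epsilon> A" shows "val f a = app f a"
proof -
  have *: "\<forall>f a. coll (\<lambda>z. \<exists>b. pair a b \<epsilon> f \<and> z \<epsilon> b)"
    by (rule coll2, (rule strat_intros)+)
  have "z \<epsilon> val f a \<longleftrightarrow> (\<exists>b. pair a b \<epsilon> f \<and> z \<epsilon> b)" for z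
    unfolding val_def using * by (simp add: mem_setof)
  then show ?thesis
    by (intro extensionality) (simp add: pair_mem_hom_iff[OF assms(1)] assms(2))
qed

lemma mem_ident: "p \<epsilon> ident X \<longleftrightarrow> (\<exists>x. x \<epsilon> X \<and> p = pair x x)"
proof -
  have "\<forall>X. coll (\<lambda>p. \<exists>x. x \<epsilon> X \<and> p = pair x x)"
    by (rule coll1, (rule strat_intros)+)
  then show ?thesis unfolding ident_def by (simp add: mem_setof)
qed

lemma ident_hom: "ident X \<in> hom X X"
  and app_ident: "x \<epsilon> X \<Longrightarrow> app (ident X) x = x"
  by (rule graph_hom[where Q = "\<lambda>x. x \<epsilon> X" and s = "\<lambda>x. x" and t = "\<lambda>x. x" and A = X, OF mem_ident]; simp)+

lemma mem_comp:
  "p \<epsilon> comp g f \<longleftrightarrow> (\<exists>a b c. pair a b \<epsilon> f \<and> pair b c \<epsilon> g \<and> p = pair a c)"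
proof -
  have "\<forall>g f. coll (\<lambda>p. \<exists>a b c. pair a b \<epsilon> f \<and> pair b c \<epsilon> g \<and> p = pair a c)"
    by (rule coll2, (rule strat_intros)+)
  then show ?thesis unfolding comp_def by (simp add: mem_setof)
qed

lemma comp_hom: "f \<in> hom X Y \<Longrightarrow> g \<in> hom Y Z \<Longrightarrow> comp g f \<in> hom X Z"
  and app_comp: "f \<in> hom X Y \<Longrightarrow> g \<in> hom Y Z \<Longrightarrow> x \<epsilon> X \<Longrightarrow> app (comp g f) x = app g (app f x)"
proof -
  assume f: "f \<in> hom X Y" and g: "g \<in> hom Y Z"
  have *: "p \<epsilon> comp g f \<longleftrightarrow> (\<exists>x. x \<epsilon> X \<and> p = pair x (app g (app f x)))" for p
    unfolding mem_comp pair_mem_hom_iff[OF f] pair_mem_hom_iff[OF g] using app_mem[OF f] by blast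
  note gh = graph_hom[where Q = "\<lambda>x. x \<epsilon> X" and s = "\<lambda>x. x" and A = X and B = Z, OF *]
  show "comp g f \<in> hom X Z"
    by (rule gh) (simp_all add: app_mem[OF g] app_mem[OF f])
  show "x \<epsilon> X \<Longrightarrow> app (comp g f) x = app g (app f x)"
    by (rule gh) (simp_all add: app_mem[OF g] app_mem[OF f])
qed

section \<open>The three functors\<close>

lemma obj_T: "obj T_functor X = singletons X"
  by (simp add: T_functor_def singletons_def)

lemma mem_mor_T:
  assumes "f \<in> hom X Y"
  shows "p \<epsilon> mor T_functor X Y f \<longleftrightarrow> (\<exists>x. x \<epsilon> X \<and> p = pair (sing x) (sing (app f x)))"
proof -
  have *: "\<forall>X f. coll (\<lambda>p. \<exists>x. x \<epsilon> X \<and> p = pair (sing x) (sing (val f x)))"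
    by (rule coll2, (rule strat_intros)+)
  have "(\<lambda>p. \<exists>x. x \<epsilon> X \<and> p = pair (sing x) (sing (app f x))) =
      (\<lambda>p. \<exists>x. x \<epsilon> X \<and> p = pair (sing x) (sing (val f x)))"
    using val_app[OF assms] by (intro ext) metis
  then have "coll (\<lambda>p. \<exists>x. x \<epsilon> X \<and> p = pair (sing x) (sing (app f x)))"
    using * by simp
  then show ?thesis by (simp add: T_functor_def mem_setof)
qed

lemma mor_T_hom: "f \<in> hom X Y \<Longrightarrow> mor T_functor X Y f \<in> hom (singletons X) (singletons Y)"
  and app_mor_T: "f \<in> hom X Y \<Longrightarrow> x \<epsilon> X \<Longrightarrow> app (mor T_functor X Y f) (sing x) = sing (app f x)"
proof -
  assume f: "f \<in> hom X Y"
  note gh = graph_hom[where Q = "\<lambda>x. x \<epsilon> X" and s = sing and A = "singletons X" and B = "singletons Y",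
      OF mem_mor_T[OF f]]
  show "mor T_functor X Y f \<in> hom (singletons X) (singletons Y)"
    by (rule gh) (auto simp: app_mem[OF f])
  show "x \<epsilon> X \<Longrightarrow> app (mor T_functor X Y f) (sing x) = sing (app f x)"
    by (rule gh) (auto simp: app_mem[OF f])
qed

lemma endofunctor_T: "is_endofunctor T_functor"
  unfolding is_endofunctor_def obj_T
proof (intro conjI allI ballI)
  show "mor T_functor X Y f \<in> hom (singletons X) (singletons Y)" if "f \<in> hom X Y" for X Y f
    using that by (rule mor_T_hom)
next
  fix X
  show "mor T_functor X X (ident X) = ident (singletons X)"
    by (rule hom_eqI[OF mor_T_hom[OF ident_hom] ident_hom])
      (auto simp: app_mor_T[OF ident_hom] app_ident)
next
  fix X Y Z f g assume f: "f \<in> hom X Y" and g: "g \<in> hom Y Z"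
  show "mor T_functor X Z (comp g f) = comp (mor T_functor Y Z g) (mor T_functor X Y f)"
    by (rule hom_eqI[OF mor_T_hom[OF comp_hom[OF f g]] comp_hom[OF mor_T_hom[OF f] mor_T_hom[OF g]]])
      (auto simp: app_mor_T[OF comp_hom[OF f g]] app_comp[OF f g] app_mor_T[OF f] app_mor_T[OF g]
        app_comp[OF mor_T_hom[OF f] mor_T_hom[OF g]] app_mem[OF f])
qed

lemma obj_prod: "obj (prod_functor A) X = prod A X"
  by (simp add: prod_functor_def)

lemma mem_mor_prod:
  assumes "f \<in> hom X Y"
  shows "p \<epsilon> mor (prod_functor A) X Y f \<longleftrightarrow>
    (\<exists>a x. a \<epsilon> A \<and> x \<epsilon> X \<and> p = pair (pair a x) (pair a (app f x)))"
proof -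
  have *: "\<forall>A X f. coll (\<lambda>p. \<exists>a x. a \<epsilon> A \<and> x \<epsilon> X \<and> p = pair (pair a x) (pair a (val f x)))"
    by (rule coll3, (rule strat_intros)+)
  have "(\<lambda>p. \<exists>a x. a \<epsilon> A \<and> x \<epsilon> X \<and> p = pair (pair a x) (pair a (app f x))) =
      (\<lambda>p. \<exists>a x. a \<epsilon> A \<and> x \<epsilon> X \<and> p = pair (pair a x) (pair a (val f x)))"
    using val_app[OF assms] by (intro ext) metis
  then have "coll (\<lambda>p. \<exists>a x. a \<epsilon> A \<and> x \<epsilon> X \<and> p = pair (pair a x) (pair a (app f x)))"
    using * by simp
  then show ?thesis by (simp add: prod_functor_def mem_setof)
qed

lemma mor_prod_hom: "f \<in> hom X Y \<Longrightarrow> mor (prod_functor A) X Y f \<in> hom (prod A X) (prod A Y)"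
  and app_mor_prod: "f \<in> hom X Y \<Longrightarrow> a \<epsilon> A \<Longrightarrow> x \<epsilon> X \<Longrightarrow>
    app (mor (prod_functor A) X Y f) (pair a x) = pair a (app f x)"
proof -
  assume f: "f \<in> hom X Y"
  have "p \<epsilon> mor (prod_functor A) X Y f \<longleftrightarrow> (\<exists>q. (fst q \<epsilon> A \<and> snd q \<epsilon> X) \<and>
      p = pair (pair (fst q) (snd q)) (pair (fst q) (app f (snd q))))" for p
    by (simp only: mem_mor_prod[OF f] split_paired_Ex fst_conv snd_conv conj_assoc)
  note gh = graph_hom[where Q = "\<lambda>q. fst q \<epsilon> A \<and> snd q \<epsilon> X" and s = "\<lambda>q. pair (fst q) (snd q)"
      and A = "prod A X" and B = "prod A Y", OF this]
  have 1: "p \<epsilon> prod A X \<longleftrightarrow> (\<exists>q. (fst q \<epsilon> A \<and> snd q \<epsilon> X) \<and> p = pair (fst q) (snd q))" for p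
    by (simp only: mem_prod split_paired_Ex fst_conv snd_conv conj_assoc)
  show "mor (prod_functor A) X Y f \<in> hom (prod A X) (prod A Y)"
    by (rule gh[OF 1]) (simp_all add: app_mem[OF f])
  have "app (mor (prod_functor A) X Y f) (pair (fst q) (snd q)) = pair (fst q) (app f (snd q))"
    if "fst q \<epsilon> A \<and> snd q \<epsilon> X" for q
    by (rule gh(2)[OF 1 _ _ that]) (simp_all add: app_mem[OF f])
  from this[of "(a, x)"]
  show "a \<epsilon> A \<Longrightarrow> x \<epsilon> X \<Longrightarrow> app (mor (prod_functor A) X Y f) (pair a x) = pair a (app f x)"
    by simp
qed

lemma endofunctor_prod: "is_endofunctor (prod_functor A)"
  unfolding is_endofunctor_def obj_prod
proof (intro conjI allI ballI)
  show "mor (prod_functor A) X Y f \<in> hom (prod A X) (prod A Y)" if "f \<in> hom X Y" for X Y f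
    using that by (rule mor_prod_hom)
next
  fix X
  show "mor (prod_functor A) X X (ident X) = ident (prod A X)"
    by (rule hom_eqI[OF mor_prod_hom[OF ident_hom] ident_hom])
      (auto simp: mem_prod app_mor_prod[OF ident_hom] app_ident)
next
  fix X Y Z f g assume f: "f \<in> hom X Y" and g: "g \<in> hom Y Z"
  show "mor (prod_functor A) X Z (comp g f) =
      comp (mor (prod_functor A) Y Z g) (mor (prod_functor A) X Y f)"
    by (rule hom_eqI[OF mor_prod_hom[OF comp_hom[OF f g]]
          comp_hom[OF mor_prod_hom[OF f] mor_prod_hom[OF g]]])
      (auto simp: mem_prod app_mor_prod[OF comp_hom[OF f g]] app_comp[OF f g] app_mor_prod[OF f]
        app_mor_prod[OF g] app_comp[OF mor_prod_hom[OF f] mor_prod_hom[OF g]] app_mem[OF f])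
qed

lemma mem_obj_exp: "f \<epsilon> obj (exp_functor A) X \<longleftrightarrow> f \<in> hom A X"
proof -
  have "\<forall>A X. coll (\<lambda>f. f \<in> hom A X)" by (rule coll2, (rule strat_intros)+)
  then show ?thesis by (simp add: exp_functor_def mem_setof)
qed

lemma mem_mor_exp:
  "p \<epsilon> mor (exp_functor A) X Y k \<longleftrightarrow> (\<exists>f. f \<in> hom A X \<and> p = pair f (comp k f))"
proof -
  have "\<forall>A X k. coll (\<lambda>p. \<exists>f. f \<in> hom A X \<and> p = pair f (comp k f))"
    by (rule coll3, (rule strat_intros)+)
  then show ?thesis by (simp add: exp_functor_def mem_setof)
qed

lemma mor_exp_hom: "k \<in> hom X Y \<Longrightarrow>
    mor (exp_functor A) X Y k \<in> hom (obj (exp_functor A) X) (obj (exp_functor A) Y)"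
  and app_mor_exp: "k \<in> hom X Y \<Longrightarrow> f \<in> hom A X \<Longrightarrow> app (mor (exp_functor A) X Y k) f = comp k f"
proof -
  assume k: "k \<in> hom X Y"
  note gh = graph_hom[where Q = "\<lambda>f. f \<in> hom A X" and s = "\<lambda>f. f"
      and A = "obj (exp_functor A) X" and B = "obj (exp_functor A) Y", OF mem_mor_exp]
  show "mor (exp_functor A) X Y k \<in> hom (obj (exp_functor A) X) (obj (exp_functor A) Y)"
    by (rule gh) (simp_all add: mem_obj_exp comp_hom[OF _ k])
  show "f \<in> hom A X \<Longrightarrow> app (mor (exp_functor A) X Y k) f = comp k f"
    by (rule gh) (simp_all add: mem_obj_exp comp_hom[OF _ k])
qed

lemma comp_ident: "f \<in> hom X Y \<Longrightarrow> comp (ident Y) f = f"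
  by (rule hom_eqI[OF comp_hom[OF _ ident_hom]])
    (auto simp: app_comp[OF _ ident_hom] app_ident app_mem)

lemma comp_assoc:
  assumes f: "f \<in> hom W X" and g: "g \<in> hom X Y" and h: "h \<in> hom Y Z"
  shows "comp (comp h g) f = comp h (comp g f)"
  by (rule hom_eqI[OF comp_hom[OF f comp_hom[OF g h]] comp_hom[OF comp_hom[OF f g] h]])
    (simp add: app_comp[OF f comp_hom[OF g h]] app_comp[OF comp_hom[OF f g] h]
      app_comp[OF f g] app_comp[OF g h] app_mem[OF f])

lemma endofunctor_exp: "is_endofunctor (exp_functor A)"
  unfolding is_endofunctor_def
proof (intro conjI allI ballI)
  show "mor (exp_functor A) X Y k \<in> hom (obj (exp_functor A) X) (obj (exp_functor A) Y)"
    if "k \<in> hom X Y" for X Y k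
    using that by (rule mor_exp_hom)
next
  fix X
  show "mor (exp_functor A) X X (ident X) = ident (obj (exp_functor A) X)"
    by (rule hom_eqI[OF mor_exp_hom[OF ident_hom] ident_hom])
      (simp add: mem_obj_exp app_mor_exp[OF ident_hom] app_ident comp_ident)
next
  fix X Y Z f g assume f: "f \<in> hom X Y" and g: "g \<in> hom Y Z"
  show "mor (exp_functor A) X Z (comp g f) =
      comp (mor (exp_functor A) Y Z g) (mor (exp_functor A) X Y f)"
    by (rule hom_eqI[OF mor_exp_hom[OF comp_hom[OF f g]]
          comp_hom[OF mor_exp_hom[OF f] mor_exp_hom[OF g]]])
      (simp add: mem_obj_exp app_mor_exp[OF comp_hom[OF f g]] app_mor_exp[OF f] app_mor_exp[OF g]
        app_comp[OF mor_exp_hom[OF f] mor_exp_hom[OF g]] comp_hom[OF _ f] comp_assoc[OF _ f g])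
qed

section \<open>Transposition\<close>

lemma mem_curry_at:
  assumes "f \<in> hom (prod A X) Y" "c \<epsilon> X"
  shows "q \<epsilon> curry_at A f c \<longleftrightarrow> (\<exists>a. a \<epsilon> A \<and> q = pair a (app f (pair a c)))"
proof -
  have *: "\<forall>A f c. coll (\<lambda>q. \<exists>a b. a \<epsilon> A \<and> pair (pair a c) b \<epsilon> f \<and> q = pair a b)"
    by (rule coll3, (rule strat_intros)+)
  have "q \<epsilon> curry_at A f c \<longleftrightarrow> (\<exists>a b. a \<epsilon> A \<and> pair (pair a c) b \<epsilon> f \<and> q = pair a b)"
    unfolding curry_at_def using * by (simp add: mem_setof)
  then show ?thesis unfolding pair_mem_hom_iff[OF assms(1)] pair_mem_prod using assms(2) by simp
qed

lemma curry_at_hom: "f \<in> hom (prod A X) Y \<Longrightarrow> c \<epsilon> X \<Longrightarrow> curry_at A f c \<in> hom A Y"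
  and app_curry_at: "f \<in> hom (prod A X) Y \<Longrightarrow> c \<epsilon> X \<Longrightarrow> a \<epsilon> A \<Longrightarrow>
    app (curry_at A f c) a = app f (pair a c)"
proof -
  assume f: "f \<in> hom (prod A X) Y" and c: "c \<epsilon> X"
  note gh = graph_hom[where Q = "\<lambda>a. a \<epsilon> A" and s = "\<lambda>a. a" and A = A and B = Y,
      OF mem_curry_at[OF f c]]
  show "curry_at A f c \<in> hom A Y" by (rule gh) (simp_all add: app_mem[OF f] c)
  show "a \<epsilon> A \<Longrightarrow> app (curry_at A f c) a = app f (pair a c)"
    by (rule gh) (simp_all add: app_mem[OF f] c)
qed

lemma mem_transpose:
  "p \<epsilon> transpose A X f \<longleftrightarrow> (\<exists>c. c \<epsilon> X \<and> p = pair (sing c) (curry_at A f c))"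
proof -
  have "\<forall>A X f. coll (\<lambda>p. \<exists>c. c \<epsilon> X \<and> p = pair (sing c) (curry_at A f c))"
    unfolding curry_at_def by (rule coll3, (rule strat_intros)+)
  then show ?thesis unfolding transpose_def by (simp add: mem_setof)
qed

lemma transpose_hom: "f \<in> hom (prod A X) Y \<Longrightarrow>
    transpose A X f \<in> hom (singletons X) (obj (exp_functor A) Y)"
  and app_transpose: "f \<in> hom (prod A X) Y \<Longrightarrow> c \<epsilon> X \<Longrightarrow>
    app (transpose A X f) (sing c) = curry_at A f c"
proof -
  assume f: "f \<in> hom (prod A X) Y"
  note gh = graph_hom[where Q = "\<lambda>c. c \<epsilon> X" and s = sing and A = "singletons X"
      and B = "obj (exp_functor A) Y", OF mem_transpose]
  show "transpose A X f \<in> hom (singletons X) (obj (exp_functor A) Y)"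
    by (rule gh) (simp_all add: mem_obj_exp curry_at_hom[OF f])
  show "c \<epsilon> X \<Longrightarrow> app (transpose A X f) (sing c) = curry_at A f c"
    by (rule gh) (simp_all add: mem_obj_exp curry_at_hom[OF f])
qed

lemma app_exp_hom:
  "g \<in> hom (singletons X) (obj (exp_functor A) Y) \<Longrightarrow> c \<epsilon> X \<Longrightarrow> app g (sing c) \<in> hom A Y"
  using app_mem[of g "singletons X" "obj (exp_functor A) Y" "sing c"] by (simp add: mem_obj_exp)

lemma transpose_inject:
  assumes f: "f \<in> hom (prod A X) Y" and f': "f' \<in> hom (prod A X) Y"
    and eq: "transpose A X f = transpose A X f'"
  shows "f = f'"
proof (rule hom_eqI[OF f f'])
  fix p assume "p \<epsilon> prod A X"
  then obtain a c where p: "a \<epsilon> A" "c \<epsilon> X" "p = pair a c" unfolding mem_prod by blast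
  have "curry_at A f c = curry_at A f' c"
    using app_transpose[OF f p(2)] app_transpose[OF f' p(2)] eq by simp
  then show "app f p = app f' p"
    using app_curry_at[OF f p(2,1)] app_curry_at[OF f' p(2,1)] p(3) by simp
qed

text \<open>The inverse image of \<open>g\<close> is \<open>(a, c) \<mapsto> g {c} a\<close>, whose graph is again stratified: \<open>g {c}\<close> is a
set of pairs one level above \<open>a\<close>, as is \<open>{c}\<close>.\<close>

lemma transpose_surj:
  assumes g: "g \<in> hom (singletons X) (obj (exp_functor A) Y)"
  shows "\<exists>f. f \<in> hom (prod A X) Y \<and> transpose A X f = g"
proof -
  have *: "\<forall>A X g. coll (\<lambda>p. \<exists>a c. a \<epsilon> A \<and> c \<epsilon> X \<and> p = pair (pair a c) (val (val g (sing c)) a))"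
    by (rule coll3, (rule strat_intros)+)
  define f where
    "f = setof (\<lambda>p. \<exists>a c. a \<epsilon> A \<and> c \<epsilon> X \<and> p = pair (pair a c) (val (val g (sing c)) a))"
  have val: "val (val g (sing c)) a = app (app g (sing c)) a" if "a \<epsilon> A" "c \<epsilon> X" for a c
    using that val_app[OF g, of "sing c"] val_app[OF app_exp_hom[OF g]] by simp
  have "p \<epsilon> f \<longleftrightarrow> (\<exists>a c. a \<epsilon> A \<and> c \<epsilon> X \<and> p = pair (pair a c) (val (val g (sing c)) a))" for p
    unfolding f_def using * by (simp add: mem_setof)
  then have "p \<epsilon> f \<longleftrightarrow> (\<exists>q. (fst q \<epsilon> A \<and> snd q \<epsilon> X) \<and>
      p = pair (pair (fst q) (snd q)) (app (app g (sing (snd q))) (fst q)))" for p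
    unfolding split_paired_Ex fst_conv snd_conv using val by metis
  note gh = graph_hom[where Q = "\<lambda>q. fst q \<epsilon> A \<and> snd q \<epsilon> X" and s = "\<lambda>q. pair (fst q) (snd q)"
      and A = "prod A X" and B = Y, OF this]
  have 1: "p \<epsilon> prod A X \<longleftrightarrow> (\<exists>q. (fst q \<epsilon> A \<and> snd q \<epsilon> X) \<and> p = pair (fst q) (snd q))" for p
    by (simp only: mem_prod split_paired_Ex fst_conv snd_conv conj_assoc)
  have f: "f \<in> hom (prod A X) Y"
    by (rule gh[OF 1]) (simp_all add: app_mem[OF app_exp_hom[OF g]])
  have "app f (pair (fst q) (snd q)) = app (app g (sing (snd q))) (fst q)"
    if "fst q \<epsilon> A \<and> snd q \<epsilon> X" for q
    by (rule gh(2)[OF 1 _ _ that]) (simp_all add: app_mem[OF app_exp_hom[OF g]])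
  from this[of "(a, c)" for a c]
  have app_f: "app f (pair a c) = app (app g (sing c)) a" if "a \<epsilon> A" "c \<epsilon> X" for a c
    using that by simp
  have "transpose A X f = g"
  proof (rule hom_eqI[OF transpose_hom[OF f] g])
    fix s assume "s \<epsilon> singletons X"
    then obtain c where c: "c \<epsilon> X" "s = sing c" by auto
    have "curry_at A f c = app g (sing c)"
      by (rule hom_eqI[OF curry_at_hom[OF f c(1)] app_exp_hom[OF g c(1)]])
        (simp add: app_curry_at[OF f c(1)] app_f c(1))
    then show "app (transpose A X f) s = app g s"
      using c by (simp add: app_transpose[OF f])
  qed
  with f show ?thesis by blast
qed

text \<open>Both sides are functions on singletons of elements of \<open>X'\<close>, and their values are functions on \<open>A\<close>,
so it suffices to evaluate twice; both sides then give \<open>k (f (a, h c))\<close>.\<close>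

lemma transpose_natural:
  assumes h: "h \<in> hom X' X" and k: "k \<in> hom Y Y'" and f: "f \<in> hom (prod A X) Y"
  shows "transpose A X' (comp k (comp f (mor (prod_functor A) X' X h))) =
    comp (mor (exp_functor A) Y Y' k) (comp (transpose A X f) (mor T_functor X' X h))"
proof -
  note Ah = mor_prod_hom[OF h, of A]
  note fAh = comp_hom[OF Ah f]
  note kfAh = comp_hom[OF fAh k]
  note Th = mor_T_hom[OF h]
  note fTh = comp_hom[OF Th transpose_hom[OF f]]
  note kfTh = comp_hom[OF fTh mor_exp_hom[OF k]]
  show ?thesis
  proof (rule hom_eqI[OF transpose_hom[OF kfAh] kfTh])
    fix s assume "s \<epsilon> singletons X'"
    then obtain c where c: "c \<epsilon> X'" "s = sing c" by auto
    note hc = app_mem[OF h c(1)]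
    note curry = curry_at_hom[OF f hc]
    have "curry_at A (comp k (comp f (mor (prod_functor A) X' X h))) c =
        comp k (curry_at A f (app h c))"
    proof (rule hom_eqI[OF curry_at_hom[OF kfAh c(1)] comp_hom[OF curry k]])
      fix a assume a: "a \<epsilon> A"
      then show "app (curry_at A (comp k (comp f (mor (prod_functor A) X' X h))) c) a =
          app (comp k (curry_at A f (app h c))) a"
        using c(1) hc by (simp add: app_curry_at[OF kfAh] app_comp[OF fAh k] app_comp[OF Ah f]
            app_mor_prod[OF h] app_comp[OF curry k] app_curry_at[OF f])
    qed
    then show "app (transpose A X' (comp k (comp f (mor (prod_functor A) X' X h)))) s =
        app (comp (mor (exp_functor A) Y Y' k) (comp (transpose A X f) (mor T_functor X' X h))) s"
      using c hc by (simp add: app_transpose[OF kfAh] app_comp[OF fTh mor_exp_hom[OF k]]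
          app_comp[OF Th transpose_hom[OF f]] app_mor_T[OF h] app_transpose[OF f]
          app_mor_exp[OF k] curry)
  qed
qed

lemma transpose_adjunction:
  "relative_adjunction T_functor (prod_functor A) (exp_functor A) (\<lambda>X Y. transpose A X)"
  unfolding relative_adjunction_def obj_T obj_prod bij_betw_def
proof (intro conjI allI ballI)
  show "inj_on (transpose A X) (hom (prod A X) Y)" for X Y
    by (rule inj_onI) (rule transpose_inject)
  show "transpose A X ` hom (prod A X) Y = hom (singletons X) (obj (exp_functor A) Y)" for X Y
    using transpose_hom transpose_surj by blast
next
  fix X X' Y Y' h k f
  assume "h \<in> hom X' X" "k \<in> hom Y Y'" "f \<in> hom (prod A X) Y"
  then show "transpose A X' (comp k (comp f (mor (prod_functor A) X' X h))) =
    comp (mor (exp_functor A) Y Y' k) (comp (transpose A X f) (mor T_functor X' X h))"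
    by (rule transpose_natural)
qed (rule endofunctor_T endofunctor_prod endofunctor_exp)+

end

text \<open>The calculus is applied to the family of all models at once, so it yields one formula for all of them.\<close>

lemma transpose_definable:
  "\<exists>p. \<forall>E :: 'a \<Rightarrow> 'a \<Rightarrow> bool. NF E \<longrightarrow> (\<forall>A. nf_structure.defined_by E p A
     (nf_structure.prod_functor E A) (\<lambda>X Y. nf_structure.transpose E A X))"
proof -
  interpret NF_family "{E :: 'a \<Rightarrow> 'a \<Rightarrow> bool. NF E}" "\<lambda>E. E"
    by (rule NF_family.intro) simp
  \<comment> \<open>Pairs can be formed from level 4 on, so 5 is the lowest level for a set of pairs; the transpose lies one above.\<close>
  define k :: nat where "k = Suc (Suc (Suc (Suc (Suc 0))))"
  have "stratified [k, k, k, k, Suc k]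
      (\<lambda>E e. e (Suc (Suc (Suc (Suc 0)))) = nf_structure.transpose E (e 0) (e (Suc 0)) (e (Suc (Suc (Suc 0)))))"
    unfolding nf_structure.transpose_def nf_structure.curry_at_def k_def by (rule strat_intros)+
  from stratified_uniform_formula[OF this] obtain p where p: "\<forall>E :: 'a \<Rightarrow> 'a \<Rightarrow> bool. E \<in> {E. NF E} \<longrightarrow> (\<forall>e.
      sat E e p \<longleftrightarrow> e (Suc (Suc (Suc (Suc 0)))) =
        nf_structure.transpose E (e 0) (e (Suc 0)) (e (Suc (Suc (Suc 0)))))"
    by (rule exE)
  then have "sat E e p \<longleftrightarrow> e (Suc (Suc (Suc (Suc 0)))) =
      nf_structure.transpose E (e 0) (e (Suc 0)) (e (Suc (Suc (Suc 0))))" if "NF E"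
    for E :: "'a \<Rightarrow> 'a \<Rightarrow> bool" and e
    using p that by simp
  then show ?thesis
    by (intro exI[of _ p]) (simp add: nf_structure.defined_by_def eval_nat_numeral)
qed

theorem proposition13:
  "\<exists>p. \<forall>E :: 'a \<Rightarrow> 'a \<Rightarrow> bool. NF E \<longrightarrow>
     (\<forall>A. \<exists>\<Phi>.
        nf_structure.relative_adjunction E
          (nf_structure.T_functor E)
          (nf_structure.prod_functor E A)
          (nf_structure.exp_functor E A) \<Phi> \<and>
        nf_structure.defined_by E p A (nf_structure.prod_functor E A) \<Phi>)"
proof -
  obtain p where p: "\<forall>E :: 'a \<Rightarrow> 'a \<Rightarrow> bool. NF E \<longrightarrow> (\<forall>A. nf_structure.defined_by E p A
     (nf_structure.prod_functor E A) (\<lambda>X Y. nf_structure.transpose E A X))"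
    using transpose_definable by (rule exE)
  show ?thesis
  proof (intro exI[of _ p] allI impI)
    fix E :: "'a \<Rightarrow> 'a \<Rightarrow> bool" and A
    assume E: "NF E"
    show "\<exists>\<Phi>. nf_structure.relative_adjunction E (nf_structure.T_functor E)
          (nf_structure.prod_functor E A) (nf_structure.exp_functor E A) \<Phi> \<and>
        nf_structure.defined_by E p A (nf_structure.prod_functor E A) \<Phi>"
      by (rule exI, rule conjI[OF NF.transpose_adjunction[OF E] p[rule_format, OF E]])
  qed
qed

end
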